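(* Let $K$ be a field of characteristic $0$ and let $I\subset K[X]=K[x_1,x_2,\dots]$ be a homogeneous symmetric ideal. For $n\ge 1$ let $I_n=I\cap K[x_1,\dots,x_n]$. Then the coefficientwise limit \[ \lim_{n\to\infty} H\big((K[X_n]/I_n)^{\mathrm{Sym}};\,t\big) \] exists as a formal power series in $t$ with non-negative integer coefficients. Moreover, this limit is a rational function of $t$ provided the following condition $(\dagger)$ holds: there exists $f\in I$ which can be written $f=\sum_{i=1}^N c_i m_i$ with $N\ge 1$, $c_i\in K\setminus\{0\}$ and $m_1,\dots,m_N$ pairwise distinct monomials, such that $\mathrm{Supp}(m_i)\not\subset \mathrm{Supp}(m_1)$ for all $i\neq 1$.
   Context: $K[X]=K[x_i\mid i\ge1]$ is the polynomial ring in countably many variables, graded by degree, and $K[X_n]=K[x_1,\dots,x_n]$. $\mathrm{Sym}(\infty)=\bigcup_{n\ge1}\mathrm{Sym}(n)$ acts on $K[X]$ by $\sigma\cdot x_i=x_{\sigma(i)}$, and $\mathrm{Sym}(n)$ acts in the same way on $K[X_n]$. An ideal $I\subset K[X]$ is symmetric if it is stable under $\mathrm{Sym}(\infty)$; then $I_n=I\cap K[X_n]$ is a homogeneous $\mathrm{Sym}(n)$-stable ideal of $K[X_n]$. $(K[X_n]/I_n)^{\mathrm{Sym}}$ denotes the graded subspace of $\mathrm{Sym}(n)$-invariants of $K[X_n]/I_n$ (isomorphic to $K[X_n]^{\mathrm{Sym}}/I_n^{\mathrm{Sym}}$). For a graded vector space $M$ with finite-dimensional graded pieces, $H(M;t)=\sum_{d\ge0}\dim_K[M]_d\,t^d$.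 $\mathrm{Supp}(m)$ is the set of variables appearing in the monomial $m$. *)

theory Defs
  imports
    "HOL-Library.Poly_Mapping"
    "HOL-Combinatorics.Permutations"
    "HOL-Algebra.QuotRing"
    "HOL-Computational_Algebra.Polynomial_FPS"
    "Jordan_Normal_Form.VS_Connect"
begin

text \<open>
  Polynomials in countably many variables, as finitely supported coefficient functions on
  exponent vectors. Index \<open>i :: nat\<close> stands for the variable \<open>x\<^bsub>i+1\<^esub>\<close>, so that
  \<open>{..<n}\<close> is the set of the first \<open>n\<close> variables. The support of a monomial \<open>m\<close> is
  \<^term>\<open>Poly_Mapping.keys m\<close>.
\<close>

type_synonym monom = "nat \<Rightarrow>\<^sub>0 nat"
type_synonym 'a mpoly = "monom \<Rightarrow>\<^sub>0 'a"

abbreviation KX :: "'a::comm_ring_1 mpoly ring" where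
  "KX \<equiv> class_ring"

definition KXn :: "nat \<Rightarrow> 'a::comm_ring_1 mpoly ring" where
  "KXn n = KX\<lparr>carrier :=
     {f. \<forall>m\<in>Poly_Mapping.keys f. Poly_Mapping.keys m \<subseteq> {..<n}}\<rparr>"


definition monom_degree :: "monom \<Rightarrow> nat" where
  "monom_degree m = (\<Sum>i\<in>Poly_Mapping.keys m. Poly_Mapping.lookup m i)"

definition homogeneous :: "nat \<Rightarrow> 'a::comm_ring_1 mpoly \<Rightarrow> bool" where
  "homogeneous d f \<longleftrightarrow> (\<forall>m\<in>Poly_Mapping.keys f. monom_degree m = d)"

definition homogeneous_component :: "nat \<Rightarrow> 'a::comm_ring_1 mpoly \<Rightarrow> 'a mpoly" where
  "homogeneous_component d f =
     (\<Sum>m\<in>{m \<in> Poly_Mapping.keys f. monom_degree m = d}.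
        Poly_Mapping.single m (Poly_Mapping.lookup f m))"

definition homogeneous_ideal :: "'a::comm_ring_1 mpoly set \<Rightarrow> bool" where
  "homogeneous_ideal I \<longleftrightarrow> ideal I KX \<and> (\<forall>f\<in>I. \<forall>d. homogeneous_component d f \<in> I)"


definition act_monom :: "(nat \<Rightarrow> nat) \<Rightarrow> monom \<Rightarrow> monom" where
  "act_monom \<sigma> m =
     (\<Sum>i\<in>Poly_Mapping.keys m. Poly_Mapping.single (\<sigma> i) (Poly_Mapping.lookup m i))"

definition act :: "(nat \<Rightarrow> nat) \<Rightarrow> 'a::comm_ring_1 mpoly \<Rightarrow> 'a mpoly" where
  "act \<sigma> f =
     (\<Sum>m\<in>Poly_Mapping.keys f. Poly_Mapping.single (act_monom \<sigma> m) (Poly_Mapping.lookup f m))"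

definition Sym :: "nat \<Rightarrow> (nat \<Rightarrow> nat) set" where
  "Sym n = {\<sigma>. \<sigma> permutes {..<n}}"

definition Sym_infinity :: "(nat \<Rightarrow> nat) set" where
  "Sym_infinity = (\<Union>n\<in>{1..}. Sym n)"

definition symmetric_ideal :: "'a::comm_ring_1 mpoly set \<Rightarrow> bool" where
  "symmetric_ideal I \<longleftrightarrow> ideal I KX \<and> (\<forall>\<sigma>\<in>Sym_infinity. \<forall>f\<in>I. act \<sigma> f \<in> I)"


definition restr :: "'a::comm_ring_1 mpoly set \<Rightarrow> nat \<Rightarrow> 'a mpoly set" where
  "restr I n = I \<inter> carrier (KXn n)"

text \<open>
  The factor ring \<open>K[X\<^sub>n]/I\<^sub>n\<close>, whose elements are the cosets of \<open>I\<^sub>n\<close>, as a \<open>K\<close>-module: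
  a scalar acts as multiplication by the class of the corresponding constant polynomial.
\<close>

definition quot :: "'a::comm_ring_1 mpoly set \<Rightarrow> nat \<Rightarrow> ('a, 'a mpoly set) module" where
  "quot I n = (let Q = KXn n Quot restr I n in
     \<lparr>carrier = carrier Q, monoid.mult = (\<otimes>\<^bsub>Q\<^esub>), one = \<one>\<^bsub>Q\<^esub>, zero = \<zero>\<^bsub>Q\<^esub>, add = (\<oplus>\<^bsub>Q\<^esub>),
      smult = (\<lambda>c C. (restr I n +>\<^bsub>KXn n\<^esub> Poly_Mapping.single 0 c) \<otimes>\<^bsub>Q\<^esub> C)\<rparr>)"

text \<open>
  The degree \<open>d\<close> piece of the \<open>Sym n\<close>-invariants of \<open>K[X\<^sub>n]/I\<^sub>n\<close>. As \<open>I\<^sub>n\<close> is stable under \<open>Sym n\<close>, the induced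
  action on cosets \<open>f + I\<^sub>n \<mapsto> act \<sigma> f + I\<^sub>n\<close> is the image under \<open>act \<sigma>\<close>.
\<close>

definition quot_Sym_piece ::
  "'a::comm_ring_1 mpoly set \<Rightarrow> nat \<Rightarrow> nat \<Rightarrow> ('a, 'a mpoly set) module" where
  "quot_Sym_piece I n d = (quot I n)\<lparr>carrier :=
     {C \<in> carrier (quot I n). (\<exists>f\<in>C. homogeneous d f) \<and> (\<forall>\<sigma>\<in>Sym n. act \<sigma> ` C = C)}\<rparr>"

definition Hilbert_quot_Sym :: "'a::field mpoly set \<Rightarrow> nat \<Rightarrow> nat fps" where
  "Hilbert_quot_Sym I n = Abs_fps (\<lambda>d. vectorspace.dim class_ring (quot_Sym_piece I n d))"


definition dagger :: "'a::comm_ring_1 mpoly set \<Rightarrow> bool" where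
  "dagger I \<longleftrightarrow> (\<exists>f\<in>I. \<exists>N\<ge>1. \<exists>(c :: nat \<Rightarrow> 'a) (m :: nat \<Rightarrow> monom).
     f = (\<Sum>i=1..N. Poly_Mapping.single (m i) (c i)) \<and>
     (\<forall>i\<in>{1..N}. c i \<noteq> 0) \<and> inj_on m {1..N} \<and>
     (\<forall>i\<in>{1..N}. i \<noteq> 1 \<longrightarrow> \<not> Poly_Mapping.keys (m i) \<subseteq> Poly_Mapping.keys (m 1)))"

definition rational_fps :: "nat fps \<Rightarrow> bool" where
  "rational_fps F \<longleftrightarrow> (\<exists>p q :: rat poly. q \<noteq> 0 \<and>
     Abs_fps (\<lambda>d. of_nat (fps_nth F d)) * fps_of_poly q = fps_of_poly p)"

end

theory Submission
  imports Defs "HOL-Library.Multiset_Order"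
begin

text \<open>
  Call the multiset of exponents of a monomial its type. In characteristic 0 the invariants of
  \<open>K[X\<^sub>n]/I\<^sub>n\<close> are spanned by averages of monomials, and the average of a monomial depends only on its
  type. Ordering the types, the averages of the types of degree \<open>d\<close> that are not leading types of elements
  of \<open>I\<close> form a basis of the degree \<open>d\<close> invariants as soon as \<open>n\<close> is large enough for the finitely
  many leading types of degree \<open>d\<close> to be realised in \<open>I\<^sub>n\<close>. So the dimension is eventually constant.

  The leading types are closed under inserting an entry (multiply by a power of a new variable) and, for
  a suitable order, under adding 1 to the \<open>i\<close> largest entries if these are at least \<open>c\<close> (multiply by an
  elementary symmetric polynomial). Condition \<open>(\<dagger>)\<close> provides a leading type with \<open>r\<close> equal entries
  \<open>C \<ge> c\<close>. Hence a type that is not leading has fewer than \<open>r\<close> entries \<open>\<ge> C\<close>. For each number \<open>s < r\<close>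
  of such entries, the multiplicities of the entries below \<open>C\<close> and the gaps between the large ones
  identify the non-leading types with a down-closed set of vectors of natural numbers, and the generating
  function of such a set is rational by Dickson's lemma.
\<close>

section \<open>Rational generating functions of down-closed sets of exponent vectors\<close>

text \<open>K[X] itself has no nonconstant invariants, and the leading terms of invariants in K[X_n]
  would a priori vary with n. The coinvariants of K[X] avoid this: their coordinates
  \<open>type_coeff\<close> do not mention n and are preserved by averaging over Sym(n), so one set
  \<open>leads c\<close> serves every large n.

  The delicate point is the order on types. The multiset order alone suits multiplication by
  elementary symmetric polynomials but not (dagger): with m_1 = x_1^2 x_2^2 and m = x_1^3 x_3, the
  multiplier that takes m_1 to exponents (C, C) takes m to (C+1, C-2, 1), a larger type. Comparing
  first the total excess over a cut-off c cures this, because m has spent part of its degree outside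
  the support of m_1. The price is that columns may be added only to entries that are at least c.
  The order thus depends on f through c. This is harmless: the limit is computed for every c, so the
  number of nonleading types of a given degree is the same for all c, and c can be fixed after f is
  known.\<close>

definition fps_rat :: "rat fps \<Rightarrow> bool" where
  "fps_rat F \<longleftrightarrow> (\<exists>p q :: rat poly. q \<noteq> 0 \<and> F * fps_of_poly q = fps_of_poly p)"

lemma fps_rat_0: "fps_rat 0"
  unfolding fps_rat_def by (rule exI[of _ 0], rule exI[of _ 1]) simp

lemma fps_rat_add:
  assumes "fps_rat F" "fps_rat G"
  shows "fps_rat (F + G)"
proof -
  obtain p q where 1: "q \<noteq> 0" "F * fps_of_poly q = fps_of_poly p"
    using assms(1) unfolding fps_rat_def by blast
  obtain p' q' where 2: "q' \<noteq> 0" "G * fps_of_poly q' = fps_of_poly p'"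
    using assms(2) unfolding fps_rat_def by blast
  have "(F + G) * fps_of_poly (q * q') =
      (F * fps_of_poly q) * fps_of_poly q' + (G * fps_of_poly q') * fps_of_poly q"
    by (simp add: fps_of_poly_mult algebra_simps)
  also have "\<dots> = fps_of_poly (p * q' + p' * q)"
    by (simp only: 1 2 fps_of_poly_mult fps_of_poly_add)
  finally show ?thesis
    unfolding fps_rat_def using 1(1) 2(1)
    by (intro exI[of _ "p * q' + p' * q"] exI[of _ "q * q'"]) simp
qed

lemma fps_rat_sum: "(\<And>i. i \<in> S \<Longrightarrow> fps_rat (F i)) \<Longrightarrow> fps_rat (sum F S)"
  by (induction S rule: infinite_finite_induct) (auto simp: fps_rat_0 fps_rat_add)

lemma fps_rat_mult_poly:
  assumes "fps_rat F"
  shows "fps_rat (fps_of_poly r * F)"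
proof -
  obtain p q where 1: "q \<noteq> 0" "F * fps_of_poly q = fps_of_poly p"
    using assms unfolding fps_rat_def by blast
  have "fps_of_poly r * F * fps_of_poly q = fps_of_poly (r * p)"
    by (simp add: 1 fps_of_poly_mult mult.assoc)
  with 1 show ?thesis unfolding fps_rat_def by blast
qed

lemma fps_rat_X_power_mult: "fps_rat F \<Longrightarrow> fps_rat (fps_X ^ k * F)"
  using fps_rat_mult_poly[of F "monom 1 k"] by (simp add: fps_of_poly_monom)

lemma fps_rat_cancel:
  assumes "fps_rat (fps_of_poly r * F)" "r \<noteq> 0"
  shows "fps_rat F"
proof -
  obtain p q where 1: "q \<noteq> 0" "fps_of_poly r * F * fps_of_poly q = fps_of_poly p"
    using assms unfolding fps_rat_def by blast
  have "F * fps_of_poly (r * q) = fps_of_poly p"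
    using 1(2) by (simp add: fps_of_poly_mult mult_ac)
  with 1 assms(2) show ?thesis unfolding fps_rat_def
    by (intro exI[of _ p] exI[of _ "r * q"]) simp
qed

section \<open>Dickson's lemma and decreasing chains of down-closed sets\<close>

lemma nat_seq_mono_subseq:
  fixes s :: "nat \<Rightarrow> nat"
  shows "\<exists>f :: nat \<Rightarrow> nat. strict_mono f \<and> mono (\<lambda>k. s (f k))"
proof -
  obtain f where f: "strict_mono f" "monoseq (\<lambda>k. s (f k))"
    using seq_monosub[of s] by (auto simp: o_def)
  show ?thesis
  proof (cases "incseq (\<lambda>k. s (f k))")
    case True
    with f show ?thesis by blast
  next
    case False
    with f(2) have dec: "decseq (\<lambda>k. s (f k))" by (auto simp: monoseq_iff)
    \<comment> \<open>A decreasing sequence of naturals is constant from the place where it attains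
      its least value, and a constant tail is also increasing.\<close>
    define m where "m = (LEAST v. \<exists>k. s (f k) = v)"
    have "\<exists>k. s (f k) = m" unfolding m_def by (rule LeastI_ex) blast
    then obtain k where k: "s (f k) = m" by blast
    have "s (f (l + k)) = m" for l
    proof (rule antisym)
      show "s (f (l + k)) \<le> m" using dec k by (metis decseqD le_add2)
      show "m \<le> s (f (l + k))" unfolding m_def by (rule Least_le) blast
    qed
    moreover have "strict_mono (\<lambda>l. f (l + k))"
      using f(1) by (auto simp: strict_mono_def)
    ultimately show ?thesis by (intro exI[of _ "\<lambda>l. f (l + k)"]) (auto simp: mono_def)
  qed
qed

text \<open>The subsequence is refined one coordinate at a time; passing to a further subsequence
  keeps the monotonicity already achieved.\<close>

lemma dickson:
  fixes u :: "nat \<Rightarrow> 'i \<Rightarrow> nat"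
  assumes "finite A"
  shows "\<exists>f :: nat \<Rightarrow> nat. strict_mono f \<and> (\<forall>x\<in>A. mono (\<lambda>k. u (f k) x))"
  using assms
proof induction
  case empty
  show ?case by (intro exI[of _ id]) (simp add: strict_mono_def)
next
  case (insert x A)
  then obtain f :: "nat \<Rightarrow> nat" where f: "strict_mono f" "\<forall>x\<in>A. mono (\<lambda>k. u (f k) x)" by blast
  obtain g :: "nat \<Rightarrow> nat" where g: "strict_mono g" "mono (\<lambda>k. u (f (g k)) x)"
    using nat_seq_mono_subseq[of "\<lambda>k. u (f k) x"] by blast
  have "strict_mono (f \<circ> g)" using f(1) g(1) by (rule strict_mono_o)
  then have "strict_mono (\<lambda>k. f (g k))" by (simp only: o_def)
  moreover have "mono (\<lambda>k. u (f (g k)) y)" if "y \<in> A" for y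
    using f(2) that strict_mono_mono[OF g(1)] by (simp add: mono_def)
  ultimately show ?case using g(2) by (intro exI[of _ "\<lambda>k. f (g k)"]) simp
qed

definition down_closed :: "('i \<Rightarrow> nat) set \<Rightarrow> bool" where
  "down_closed P \<longleftrightarrow> (\<forall>u\<in>P. \<forall>v. v \<le> u \<longrightarrow> v \<in> P)"

text \<open>If all inclusions were strict, a vector could be chosen in each
  \<open>P k - P (Suc k)\<close>. By Dickson's lemma an earlier one lies below a later one, and
  down-closure puts it back into the set that it had left.\<close>

lemma down_closed_chain_stabilises:
  fixes P :: "nat \<Rightarrow> ('i \<Rightarrow> nat) set"
  assumes "finite A"
    and "\<And>k. down_closed (P k)"
    and "\<And>k. P (Suc k) \<subseteq> P k"
    and supp: "\<And>k u i. u \<in> P k \<Longrightarrow> i \<notin> A \<Longrightarrow> u i = 0"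
  shows "\<exists>k. P (Suc k) = P k"
proof (rule ccontr)
  assume "\<not> ?thesis"
  with assms(3) have "\<exists>u. u \<in> P k - P (Suc k)" for k by blast
  then obtain u where u: "\<And>k. u k \<in> P k" "\<And>k. u k \<notin> P (Suc k)" by (metis DiffE)
  obtain f :: "nat \<Rightarrow> nat" where f: "strict_mono f" "\<forall>x\<in>A. mono (\<lambda>k. u (f k) x)"
    using dickson[OF assms(1)] by blast
  have "u (f 0) \<le> u (f 1)"
  proof (rule le_funI)
    fix i show "u (f 0) i \<le> u (f 1) i"
      using f(2) supp[OF u(1)] by (cases "i \<in> A") (auto simp: mono_def)
  qed
  moreover have "u (f 1) \<in> P (Suc (f 0))"
  proof -
    have "Suc (f 0) \<le> f 1" using f(1) by (simp add: strict_mono_def Suc_leI)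
    then have "P (f 1) \<subseteq> P (Suc (f 0))" using assms(3) by (rule lift_Suc_antimono_le[rotated])
    with u(1) show ?thesis by blast
  qed
  ultimately have "u (f 0) \<in> P (Suc (f 0))" using assms(2) unfolding down_closed_def by blast
  with u(2) show False by blast
qed

text \<open>Vectors are padded with 0 outside \<open>A\<close>, so that each monomial in the
  variables of \<open>A\<close> is counted once; \<open>g i\<close> is the degree given to variable
  \<open>i\<close>.\<close>

definition exps_of_degree :: "'i set \<Rightarrow> ('i \<Rightarrow> nat) \<Rightarrow> nat \<Rightarrow> ('i \<Rightarrow> nat) set" where
  "exps_of_degree A g d = {u. (\<forall>i. i \<notin> A \<longrightarrow> u i = 0) \<and> (\<Sum>i\<in>A. g i * u i) = d}"

definition gen_fun :: "'i set \<Rightarrow> ('i \<Rightarrow> nat) \<Rightarrow> ('i \<Rightarrow> nat) set \<Rightarrow> rat fps" where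
  "gen_fun A g P = Abs_fps (\<lambda>d. of_nat (card (P \<inter> exps_of_degree A g d)))"

lemma finite_exps_of_degree:
  assumes "finite A" "\<And>i. i \<in> A \<Longrightarrow> g i > 0"
  shows "finite (exps_of_degree A g d)"
proof (rule finite_subset)
  show "exps_of_degree A g d \<subseteq> {u. \<forall>i. (i \<in> A \<longrightarrow> u i \<in> {..d}) \<and> (i \<notin> A \<longrightarrow> u i = 0)}"
  proof
    fix u assume u: "u \<in> exps_of_degree A g d"
    have "u i \<le> d" if "i \<in> A" for i
    proof -
      have "u i \<le> g i * u i" using assms(2)[OF that] by simp
      also have "\<dots> \<le> (\<Sum>i\<in>A. g i * u i)"
        using that assms(1) by (intro member_le_sum) auto
      finally show ?thesis using u by (simp add: exps_of_degree_def)
    qed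
    with u show "u \<in> {u. \<forall>i. (i \<in> A \<longrightarrow> u i \<in> {..d}) \<and> (i \<notin> A \<longrightarrow> u i = 0)}"
      by (auto simp: exps_of_degree_def)
  qed
  show "finite {u. \<forall>i. (i \<in> A \<longrightarrow> u i \<in> {..d}) \<and> (i \<notin> A \<longrightarrow> u i = (0::nat))}"
    using assms(1) by (intro finite_set_of_finite_funs) auto
qed

text \<open>Vectors with \<open>u x > 0\<close> lose one unit at \<open>x\<close>, at the cost of
  \<open>g x\<close> degrees. When \<open>P\<close> is the set of monomials outside a monomial ideal
  J, this is the exact sequence for multiplication by x, and the shifted set belongs to the colon
  ideal J : x.\<close>

lemma gen_fun_insert:
  assumes "finite A" "x \<notin> A" "\<And>i. i \<in> insert x A \<Longrightarrow> g i > 0"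
  shows "gen_fun (insert x A) g P =
    gen_fun A g P + fps_X ^ g x * gen_fun (insert x A) g {u. u(x := Suc (u x)) \<in> P}"
proof (rule fps_ext)
  fix d
  let ?B = "insert x A" and ?S = "\<lambda>u::'a \<Rightarrow> nat. u(x := Suc (u x))"
  let ?Q = "{u. ?S u \<in> P}"
  have fin: "finite (exps_of_degree ?B g d)" for d using assms by (intro finite_exps_of_degree) auto
  have sum_upd: "(\<Sum>i\<in>A. g i * (u(x := v)) i) = (\<Sum>i\<in>A. g i * u i)" for u v
    using assms(2) by (intro sum.cong) auto
  have split: "P \<inter> exps_of_degree ?B g d = (P \<inter> exps_of_degree A g d) \<union> {u \<in> P \<inter> exps_of_degree ?B g d. u x > 0}"
  proof -
    have "exps_of_degree A g d = {u \<in> exps_of_degree ?B g d. u x = 0}"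
    proof (rule Set.set_eqI, rule iffI)
      fix u assume "u \<in> exps_of_degree A g d"
      then show "u \<in> {u \<in> exps_of_degree ?B g d. u x = 0}" using assms(1,2) by (auto simp: exps_of_degree_def)
    next
      fix u assume u: "u \<in> {u \<in> exps_of_degree ?B g d. u x = 0}"
      then have "u i = 0" if "i \<notin> A" for i using that by (cases "i = x") (auto simp: exps_of_degree_def)
      with u show "u \<in> exps_of_degree A g d" using assms(1,2) by (auto simp: exps_of_degree_def)
    qed
    then show ?thesis by auto
  qed
  have "card (P \<inter> exps_of_degree ?B g d) = card (P \<inter> exps_of_degree A g d) + card {u \<in> P \<inter> exps_of_degree ?B g d. u x > 0}"
  proof (subst split, rule card_Un_disjoint)
    show "finite (P \<inter> exps_of_degree A g d)" using assms by (intro finite_Int disjI2 finite_exps_of_degree) auto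
    show "finite {u \<in> P \<inter> exps_of_degree ?B g d. u x > 0}" using fin[of d] by simp
    show "(P \<inter> exps_of_degree A g d) \<inter> {u \<in> P \<inter> exps_of_degree ?B g d. u x > 0} = {}"
      using assms(2) by (auto simp: exps_of_degree_def)
  qed
  also have "card {u \<in> P \<inter> exps_of_degree ?B g d. u x > 0} =
      (if d < g x then 0 else card (?Q \<inter> exps_of_degree ?B g (d - g x)))"
  proof (cases "d < g x")
    case True
    have "{u \<in> P \<inter> exps_of_degree ?B g d. u x > 0} = {}"
    proof (rule ccontr)
      assume "\<not> ?thesis"
      then obtain u where u: "u \<in> exps_of_degree ?B g d" "u x > 0" by auto
      have "g x \<le> g x * u x" using u(2) by simp
      also have "\<dots> \<le> d" using u(1) assms(1,2) by (auto simp: exps_of_degree_def)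
      finally show False using True by simp
    qed
    with True show ?thesis by (metis card.empty)
  next
    case False
    have "bij_betw ?S (?Q \<inter> exps_of_degree ?B g (d - g x)) {u \<in> P \<inter> exps_of_degree ?B g d. u x > 0}"
    proof (rule bij_betwI[where g = "\<lambda>u. u(x := u x - 1)"])
      show "?S \<in> (?Q \<inter> exps_of_degree ?B g (d - g x)) \<rightarrow> {u \<in> P \<inter> exps_of_degree ?B g d. u x > 0}"
      proof
        fix u assume u: "u \<in> ?Q \<inter> exps_of_degree ?B g (d - g x)"
        have "g x * u x + (\<Sum>i\<in>A. g i * u i) = d - g x"
          using u assms(1,2) by (simp add: exps_of_degree_def)
        then have "(\<Sum>i\<in>?B. g i * ?S u i) = d"
          using assms(1,2) False by (simp add: sum_upd del: fun_upd_apply) simp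
        with u show "?S u \<in> {u \<in> P \<inter> exps_of_degree ?B g d. u x > 0}" by (auto simp: exps_of_degree_def)
      qed
      show "(\<lambda>u. u(x := u x - 1)) \<in> {u \<in> P \<inter> exps_of_degree ?B g d. u x > 0} \<rightarrow> ?Q \<inter> exps_of_degree ?B g (d - g x)"
      proof
        fix u assume u: "u \<in> {u \<in> P \<inter> exps_of_degree ?B g d. u x > 0}"
        have "g x * u x + (\<Sum>i\<in>A. g i * u i) = d"
          using u assms(1,2) by (simp add: exps_of_degree_def)
        then have "(\<Sum>i\<in>?B. g i * (u(x := u x - 1)) i) = d - g x"
          using assms(1,2) u by (simp add: sum_upd del: fun_upd_apply) (simp add: algebra_simps diff_mult_distrib2)
        with u show "u(x := u x - 1) \<in> ?Q \<inter> exps_of_degree ?B g (d - g x)" by (auto simp: exps_of_degree_def)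
      qed
    qed auto
    from bij_betw_same_card[OF this] False show ?thesis by simp
  qed
  finally show "fps_nth (gen_fun ?B g P) d = fps_nth (gen_fun A g P + fps_X ^ g x * gen_fun ?B g ?Q) d"
    by (simp add: gen_fun_def fps_X_power_mult_nth)
qed

text \<open>Iterating the recursion of \<open>gen_fun_insert\<close> produces a decreasing chain of
  shifted sets. Where the chain is stationary, the same series stands on both sides and can be
  solved for; the recursion then leads back to the unshifted set.\<close>

lemma gen_fun_rational:
  assumes "finite A" "\<And>i. i \<in> A \<Longrightarrow> g i > 0" "down_closed P"
  shows "fps_rat (gen_fun A g P)"
  using assms
proof (induction A arbitrary: P rule: finite_induct)
  case empty
  have "gen_fun {} g P = (if (\<lambda>_. 0) \<in> P then 1 else 0)"
  proof (rule fps_ext)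
    fix d
    have "exps_of_degree {} g d = (if d = 0 then {\<lambda>_. 0} else {})" by (auto simp: exps_of_degree_def)
    then show "fps_nth (gen_fun {} g P) d = fps_nth (if (\<lambda>_. 0) \<in> P then 1 else 0) d"
      by (simp add: gen_fun_def)
  qed
  moreover have "fps_rat 1"
    unfolding fps_rat_def by (rule exI[of _ 1], rule exI[of _ 1]) simp
  ultimately show ?case by (simp add: fps_rat_0)
next
  case (insert x A)
  let ?B = "insert x A"
  define Q where "Q k = {u. u(x := u x + k) \<in> P}" for k
  have dQ: "down_closed (Q k)" for k
    unfolding down_closed_def Q_def
  proof (intro ballI allI impI)
    fix u v :: "'a \<Rightarrow> nat" assume "u \<in> {u. u(x := u x + k) \<in> P}" "v \<le> u"
    moreover from this have "v(x := v x + k) \<le> u(x := u x + k)" by (auto simp: le_fun_def)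
    ultimately show "v \<in> {u. u(x := u x + k) \<in> P}"
      using insert.prems unfolding down_closed_def by blast
  qed
  have Q_Suc: "{u. u(x := Suc (u x)) \<in> Q k} = Q (Suc k)" for k by (simp add: Q_def)
  have rec: "gen_fun ?B g (Q k) = gen_fun A g (Q k) + fps_X ^ g x * gen_fun ?B g (Q (Suc k))" for k
    using gen_fun_insert[of A x g "Q k"] insert unfolding Q_Suc by simp
  have IH: "fps_rat (gen_fun A g (Q k))" for k using insert dQ by blast
  \<comment> \<open>The chain argument needs vectors supported on \<open>?B\<close>. Intersecting
    with \<open>?Z\<close> loses nothing, since all counted vectors lie in it.\<close>
  let ?Z = "{u :: 'a \<Rightarrow> nat. \<forall>i. i \<notin> ?B \<longrightarrow> u i = 0}"
  have dZ: "down_closed (Q k \<inter> ?Z)" for k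
    using dQ[of k] unfolding down_closed_def by (auto simp: le_fun_def) (metis le_zero_eq)
  have "\<exists>k. Q (Suc k) \<inter> ?Z = Q k \<inter> ?Z"
  proof (rule down_closed_chain_stabilises[where A = ?B])
    show "finite ?B" using insert by simp
    show "down_closed (Q k \<inter> ?Z)" for k by (rule dZ)
    show "Q (Suc k) \<inter> ?Z \<subseteq> Q k \<inter> ?Z" for k
    proof -
      have "u \<in> Q k" if "u \<in> Q (Suc k)" for u
      proof -
        have "u(x := Suc (u x)) \<in> Q k" using that by (simp add: Q_def)
        moreover have "u \<le> u(x := Suc (u x))" by (simp add: le_fun_def)
        ultimately show ?thesis using dQ[of k] unfolding down_closed_def by blast
      qed
      then show ?thesis by blast
    qed
  qed auto
  then obtain K where K: "Q (Suc K) \<inter> ?Z = Q K \<inter> ?Z" by blast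
  have "exps_of_degree ?B g d \<subseteq> ?Z" for d by (auto simp: exps_of_degree_def)
  then have "Q (Suc K) \<inter> exps_of_degree ?B g d = Q K \<inter> exps_of_degree ?B g d" for d using K by blast
  then have "gen_fun ?B g (Q (Suc K)) = gen_fun ?B g (Q K)" by (simp add: gen_fun_def)
  with rec[of K] have "fps_of_poly (1 - monom 1 (g x)) * gen_fun ?B g (Q K) = gen_fun A g (Q K)"
    by (simp add: fps_of_poly_diff fps_of_poly_monom algebra_simps)
  with IH[of K] have "fps_rat (fps_of_poly (1 - monom 1 (g x)) * gen_fun ?B g (Q K))" by simp
  moreover have "(1 - monom 1 (g x) :: rat poly) \<noteq> 0"
  proof
    assume "(1 - monom 1 (g x) :: rat poly) = 0"
    then have "coeff (1 - monom 1 (g x) :: rat poly) 0 = 0" by simp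
    moreover have "g x > 0" using insert.prems by simp
    ultimately show False by simp
  qed
  ultimately have "fps_rat (gen_fun ?B g (Q K))" by (rule fps_rat_cancel)
  then have "fps_rat (gen_fun ?B g (Q 0))"
  proof (induction K)
    case (Suc K)
    have "fps_rat (gen_fun ?B g (Q K))"
      unfolding rec[of K] by (intro fps_rat_add fps_rat_X_power_mult IH Suc.prems)
    then show ?case by (rule Suc.IH)
  qed
  then show ?case by (simp add: Q_def)
qed

section \<open>Types of monomials\<close>

abbreviation keys :: "('k \<Rightarrow>\<^sub>0 'b::zero) \<Rightarrow> 'k set" where "keys \<equiv> Poly_Mapping.keys"
abbreviation lookup :: "('k \<Rightarrow>\<^sub>0 'b::zero) \<Rightarrow> 'k \<Rightarrow> 'b" where "lookup \<equiv> Poly_Mapping.lookup"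
abbreviation single :: "'k \<Rightarrow> 'b \<Rightarrow> ('k \<Rightarrow>\<^sub>0 'b::zero)" where "single \<equiv> Poly_Mapping.single"

text \<open>Zero exponents are left out, so the type does not depend on the number of variables and
  labels the Sym(\<infinity>)-orbit of the monomial.\<close>

definition mtype :: "monom \<Rightarrow> nat multiset" where
  "mtype m = image_mset (lookup m) (mset_set (keys m))"

lemma finite_lookup_eq: "v \<noteq> 0 \<Longrightarrow> finite {i. lookup m i = v}" for m :: monom
  by (rule finite_subset[of _ "keys m"]) (auto simp: in_keys_iff)

lemma count_mtype: "count (mtype m) v = (if v = 0 then 0 else card {i. lookup m i = v})"
proof -
  have "count (mtype m) v = card {i \<in> keys m. lookup m i = v}"
    unfolding mtype_def by (rule count_image_mset_eq_card_vimage) simp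
  also have "{i \<in> keys m. lookup m i = v} = (if v = 0 then {} else {i. lookup m i = v})"
    by (auto simp: in_keys_iff)
  finally show ?thesis by simp
qed

lemma zero_notin_mtype: "0 \<notin># mtype m"
  by (simp add: count_eq_zero_iff[symmetric] count_mtype)

lemma size_mtype: "size (mtype m) = card (keys m)"
  by (simp add: mtype_def)

lemma sum_mtype:
  assumes "finite A" "keys m \<subseteq> A" "h 0 = 0"
  shows "(\<Sum>x\<in>#mtype m. h x) = (\<Sum>i\<in>A. h (lookup m i) :: nat)"
proof -
  have "(\<Sum>x\<in>#mtype m. h x) = (\<Sum>i\<in>keys m. h (lookup m i))"
    by (simp add: mtype_def multiset.map_comp sum_unfold_sum_mset comp_def)
  also have "\<dots> = (\<Sum>i\<in>A. h (lookup m i))"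
    using assms by (intro sum.mono_neutral_left) (auto simp: in_keys_iff)
  finally show ?thesis .
qed

lemma sum_mset_mtype: "sum_mset (mtype m) = monom_degree m"
  using sum_mtype[of "keys m" m "\<lambda>x. x"] by (simp add: monom_degree_def)

lemma mtype_permute:
  assumes "bij p" "\<And>i. lookup a i = lookup b (p i)"
  shows "mtype a = mtype b"
proof (rule multiset_eqI)
  fix v
  have "bij_betw p {i. lookup a i = v} {i. lookup b i = v}"
  proof (intro bij_betw_imageI equalityI subsetI)
    show "inj_on p {i. lookup a i = v}" using assms(1) by (auto simp: bij_def inj_on_def)
    fix j assume j: "j \<in> {i. lookup b i = v}"
    obtain i where "j = p i" using assms(1) by (meson bij_pointE)
    with j assms(2) show "j \<in> p ` {i. lookup a i = v}" by auto
  qed (use assms(2) in auto)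
  then show "count (mtype a) v = count (mtype b) v"
    by (simp add: count_mtype bij_betw_same_card)
qed

text \<open>On a finite \<open>A\<close> the type also determines the number of zeros, namely what
  it leaves of \<open>card A\<close>. Hence both exponent functions take every value equally often
  on \<open>A\<close> and differ by a permutation of it.\<close>

lemma mtype_eq_permutes:
  assumes "finite A" "keys a \<subseteq> A" "keys b \<subseteq> A" "mtype a = mtype b"
  obtains p where "p permutes A" "\<And>i. lookup a i = lookup b (p i)"
proof -
  have 0: "count (image_mset (lookup m) (mset_set A)) v =
      (if v = 0 then card A - size (mtype m) else count (mtype m) v)"
    if "keys m \<subseteq> A" for m :: monom and v
  proof (cases "v = 0")
    case True
    have "{i \<in> A. lookup m i = 0} = A - keys m" by (auto simp: in_keys_iff)
    then have "card {i \<in> A. lookup m i = 0} = card A - card (keys m)"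
      using that by (simp add: card_Diff_subset)
    then show ?thesis
      using True assms(1) by (simp add: count_image_mset_eq_card_vimage size_mtype)
  next
    case False
    then have "{i \<in> A. lookup m i = v} = {i. lookup m i = v}"
      using that by (auto simp: in_keys_iff subset_iff)
    then show ?thesis
      using False assms(1) by (simp add: count_image_mset_eq_card_vimage count_mtype)
  qed
  have "image_mset (lookup a) (mset_set A) = image_mset (lookup b) (mset_set A)"
    using assms by (intro multiset_eqI) (simp add: 0)
  from image_mset_eq_implies_permutes[OF assms(1) this]
  obtain p where p: "p permutes A" "\<forall>x\<in>A. lookup a x = lookup b (p x)" by blast
  have "lookup a i = lookup b (p i)" for i
  proof (cases "i \<in> A")
    case False
    then have "i \<notin> keys a" "i \<notin> keys b" "p i = i"
      using assms(2,3) p(1) by (auto simp: permutes_not_in)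
    then show ?thesis by (simp add: in_keys_iff)
  qed (use p in auto)
  with p(1) that show ?thesis by blast
qed

lemma mtype_add_disjoint:
  assumes "keys a \<inter> keys b = {}"
  shows "mtype (a + b) = mtype a + mtype b"
proof -
  have k: "keys (a + b) = keys a \<union> keys b"
    by (auto simp: in_keys_iff lookup_add)
  have 1: "lookup (a + b) i = lookup a i" if "i \<in> keys a" for i
    using that assms by (auto simp: in_keys_iff lookup_add)
  have 2: "lookup (a + b) i = lookup b i" if "i \<in> keys b" for i
    using that assms by (auto simp: in_keys_iff lookup_add)
  show ?thesis
    unfolding mtype_def k using assms 1 2
    by (subst mset_set_Union) (auto intro!: arg_cong2[of _ _ _ _ "(+)"] image_mset_cong)
qed

lemma mtype_single: "v \<noteq> 0 \<Longrightarrow> mtype (single i v) = {#v#}"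
  by (simp add: mtype_def)

section \<open>Decreasing exponent vectors and the multiset order on types\<close>

abbreviation decr :: "monom \<Rightarrow> bool" where
  "decr m \<equiv> antimono (lookup m)"

text \<open>Let \<open>k\<close> be the first place of difference and \<open>x\<close> the entry of
  \<open>a\<close> there. Since \<open>l\<close> decreases, its entries that are at least
  \<open>x\<close> stand before \<open>k\<close>, where \<open>a\<close> agrees with it; so
  \<open>a\<close> has at least as many entries of every value from \<open>x\<close> on, and one
  more of value \<open>x\<close>.\<close>

lemma mtype_less_of_lex:
  assumes "decr l" "l < a"
  shows "mtype l < mtype a"
proof -
  obtain k where k: "lookup l k < lookup a k" "\<And>j. j < k \<Longrightarrow> lookup l j = lookup a j"
    using assms(2) by (auto simp: less_poly_mapping.rep_eq less_fun_def)
  let ?x = "lookup a k"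
  have init: "{i. lookup l i = y} \<subseteq> {i. i < k \<and> lookup a i = y}" if "lookup l k < y" for y
  proof
    fix i assume i: "i \<in> {i. lookup l i = y}"
    have "i < k"
    proof (rule ccontr)
      assume "\<not> i < k"
      then have "lookup l i \<le> lookup l k" using assms(1) by (simp add: antimonoD)
      with i that show False by simp
    qed
    with i k(2) show "i \<in> {i. i < k \<and> lookup a i = y}" by auto
  qed
  have x: "count (mtype l) ?x < count (mtype a) ?x"
  proof -
    have fin: "finite {i. lookup a i = ?x}" using k(1) by (intro finite_lookup_eq) simp
    have "{i. lookup l i = ?x} \<subset> {i. lookup a i = ?x}" using init[OF k(1)] k(1) by auto
    from psubset_card_mono[OF fin this] k(1) show ?thesis by (simp add: count_mtype)
  qed
  show ?thesis unfolding less_multiset\<^sub>H\<^sub>O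
  proof (intro conjI allI impI)
    show "mtype l \<noteq> mtype a" using x by auto
    fix y assume y: "count (mtype a) y < count (mtype l) y"
    have "y < ?x"
    proof (rule ccontr)
      assume "\<not> y < ?x"
      then have "y \<noteq> 0" "lookup l k < y" using k(1) by auto
      have "card {i. lookup l i = y} \<le> card {i. lookup a i = y}"
        using init[OF \<open>lookup l k < y\<close>] finite_lookup_eq[OF \<open>y \<noteq> 0\<close>] by (intro card_mono) auto
      with y \<open>y \<noteq> 0\<close> show False by (simp add: count_mtype)
    qed
    with x show "\<exists>x>y. count (mtype l) x < count (mtype a) x" by blast
  qed
qed

lemma lex_le_of_mtype: "decr l \<Longrightarrow> mtype a \<le> mtype l \<Longrightarrow> a \<le> l"
  using mtype_less_of_lex[of l a] by (meson leD not_le_imp_less)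

lemma decr_mtype_inject: "decr l \<Longrightarrow> decr m \<Longrightarrow> mtype l = mtype m \<Longrightarrow> l = m"
  by (intro antisym lex_le_of_mtype) auto

definition sorted_monom :: "nat multiset \<Rightarrow> monom" where
  "sorted_monom T = Poly_Mapping.nth (rev (sorted_list_of_multiset T))"

lemma lookup_sorted_monom: "lookup (sorted_monom T) i =
    (if i < size T then rev (sorted_list_of_multiset T) ! i else 0)"
proof -
  have "length (sorted_list_of_multiset T) = size T"
    by (metis mset_sorted_list_of_multiset size_mset)
  then show ?thesis by (simp add: sorted_monom_def nth_default_def)
qed

lemma decr_sorted_monom: "decr (sorted_monom T)"
proof (rule antimonoI)
  fix i j :: nat assume ij: "i \<le> j"
  have len: "length (sorted_list_of_multiset T) = size T"
    by (metis mset_sorted_list_of_multiset size_mset)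
  show "lookup (sorted_monom T) j \<le> lookup (sorted_monom T) i"
    using ij sorted_rev_nth_mono[of "rev (sorted_list_of_multiset T)" i j]
    by (simp add: lookup_sorted_monom len)
qed

lemma keys_sorted_monom:
  assumes "0 \<notin># T"
  shows "keys (sorted_monom T) = {..<size T}"
proof -
  have len: "length (sorted_list_of_multiset T) = size T"
    by (metis mset_sorted_list_of_multiset size_mset)
  have "rev (sorted_list_of_multiset T) ! i \<noteq> 0" if "i < size T" for i
  proof -
    have "rev (sorted_list_of_multiset T) ! i \<in> set (rev (sorted_list_of_multiset T))"
      using that len by (intro nth_mem) simp
    then show ?thesis using assms by (metis set_rev set_sorted_list_of_multiset)
  qed
  then show ?thesis by (auto simp: in_keys_iff lookup_sorted_monom split: if_splits)
qed

lemma mtype_sorted_monom: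
  assumes "0 \<notin># T"
  shows "mtype (sorted_monom T) = T"
proof -
  let ?l = "rev (sorted_list_of_multiset T)"
  have len: "length ?l = size T"
    by (metis length_rev mset_sorted_list_of_multiset size_mset)
  have "mtype (sorted_monom T) = image_mset ((!) ?l) (mset_set {..<size T})"
    unfolding mtype_def keys_sorted_monom[OF assms] by (intro image_mset_cong) (simp add: lookup_sorted_monom)
  also have "\<dots> = mset (map ((!) ?l) [0..<length ?l])"
    by (simp only: mset_map mset_upt len atLeast0LessThan)
  also have "\<dots> = T" by (simp only: map_nth) simp
  finally show ?thesis .
qed

lemma sorted_monom_mtype: "decr m \<Longrightarrow> sorted_monom (mtype m) = m"
  by (intro decr_mtype_inject decr_sorted_monom mtype_sorted_monom zero_notin_mtype)

text \<open>The squarefree monomial on \<open>S\<close>. Summed over all \<open>S\<close> of size i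
  among the first n variables, these give the i-th elementary symmetric polynomial.\<close>

definition ones :: "nat set \<Rightarrow> monom" where
  "ones S = (\<Sum>j\<in>S. single j 1)"

lemma lookup_ones: "finite S \<Longrightarrow> lookup (ones S) i = (if i \<in> S then 1 else 0)"
  by (simp add: ones_def lookup_sum lookup_single when_def)

lemma keys_ones: "finite S \<Longrightarrow> keys (ones S) = S"
  by (auto simp: in_keys_iff lookup_ones split: if_splits)

lemma mtype_ones: "finite S \<Longrightarrow> mtype (ones S) = replicate_mset (card S) 1"
proof -
  assume S: "finite S"
  have "mtype (ones S) = image_mset (\<lambda>_. 1) (mset_set S)"
    unfolding mtype_def keys_ones[OF S] using S by (intro image_mset_cong) (simp add: lookup_ones)
  then show ?thesis by (simp add: image_mset_const_eq)
qed

lemma decr_ones: "decr (ones {..<i})"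
  by (rule antimonoI) (simp add: lookup_ones)

text \<open>
  The cut-off \<open>c\<close> serves two purposes: among all ways to add 1 to \<open>i\<close> entries, raising \<open>i\<close> entries that
  are at least \<open>c\<close> increases the order most, and small exponents on extra variables do not count.
\<close>

definition excess :: "nat \<Rightarrow> nat multiset \<Rightarrow> nat" where
  "excess c T = (\<Sum>x\<in>#T. x - c)"

definition type_le :: "nat \<Rightarrow> nat multiset \<Rightarrow> nat multiset \<Rightarrow> bool" where
  "type_le c S T \<longleftrightarrow> excess c S < excess c T \<or> excess c S = excess c T \<and> S \<le> T"

lemma type_le_refl: "type_le c T T" by (simp add: type_le_def)
lemma type_le_trans: "type_le c S T \<Longrightarrow> type_le c T U \<Longrightarrow> type_le c S U" by (auto simp: type_le_def)
lemma type_le_antisym: "type_le c S T \<Longrightarrow> type_le c T S \<Longrightarrow> S = T" by (auto simp: type_le_def)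
lemma type_le_total: "type_le c S T \<or> type_le c T S" by (auto simp: type_le_def)

lemma type_le_add_mset: "type_le c S T \<Longrightarrow> type_le c (add_mset j S) (add_mset j T)"
  by (auto simp: type_le_def excess_def)

lemma excess_mtype: "finite A \<Longrightarrow> keys m \<subseteq> A \<Longrightarrow> excess c (mtype m) = (\<Sum>i\<in>A. lookup m i - c)"
  unfolding excess_def by (rule sum_mtype) auto

text \<open>
  On decreasing exponent vectors the multiset order on types is the lexicographic order, which is
  compatible with addition; so both sides are compared after sorting \<open>a + ones S\<close>.
\<close>

lemma column_monotone:
  assumes l: "decr l" "keys l \<subseteq> {..<n}" "i \<le> n" "\<And>j. j < i \<Longrightarrow> c \<le> lookup l j"
    and a: "keys a \<subseteq> {..<n}" "type_le c (mtype a) (mtype l)"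
    and S: "S \<subseteq> {..<n}" "card S = i"
  shows "type_le c (mtype (a + ones S)) (mtype (l + ones {..<i}))"
    and "mtype (a + ones S) = mtype (l + ones {..<i}) \<Longrightarrow> mtype a = mtype l"
proof -
  have finS: "finite S" using S(1) finite_subset by blast
  let ?b = "a + ones S" and ?l = "l + ones {..<i}"
  have kb: "keys ?b \<subseteq> {..<n}"
    using a(1) S(1) keys_ones[OF finS] keys_add[of a "ones S"] by auto
  have kl: "keys ?l \<subseteq> {..<n}"
    using l(2,3) keys_ones[of "{..<i}"] keys_add[of l "ones {..<i}"] by auto
  have card_sum: "(\<Sum>j<n. if j \<in> R then 1 else 0 :: nat) = card R" if "R \<subseteq> {..<n}" for R
    using that by (simp add: sum.If_cases Int_absorb1)
  \<comment> \<open>Raising \<open>i\<close> entries adds at most \<open>i\<close> to the excess,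
    and exactly \<open>i\<close> if all of them are at least \<open>c\<close>, as for
    \<open>l\<close> below. Only the case of equal excess is therefore left to the multiset
    order.\<close>
  have wb: "excess c (mtype ?b) \<le> excess c (mtype a) + i"
  proof -
    have "excess c (mtype ?b) = (\<Sum>j<n. lookup ?b j - c)" using kb by (intro excess_mtype) auto
    also have "\<dots> \<le> (\<Sum>j<n. (lookup a j - c) + (if j \<in> S then 1 else 0))"
      using finS by (intro sum_mono) (simp add: lookup_add lookup_ones)
    also have "\<dots> = excess c (mtype a) + i"
      using a(1) S card_sum by (simp add: sum.distrib excess_mtype[of "{..<n}" a])
    finally show ?thesis .
  qed
  have wl: "excess c (mtype ?l) = excess c (mtype l) + i"
  proof -
    have "excess c (mtype ?l) = (\<Sum>j<n. lookup ?l j - c)" using kl by (intro excess_mtype) auto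
    also have "\<dots> = (\<Sum>j<n. (lookup l j - c) + (if j \<in> {..<i} then 1 else 0))"
      using l(4) by (intro sum.cong) (auto simp: lookup_add lookup_ones Suc_diff_le)
    also have "\<dots> = excess c (mtype l) + i"
      using l(2,3) card_sum[of "{..<i}"] by (simp add: sum.distrib excess_mtype[of "{..<n}" l])
    finally show ?thesis .
  qed
  have "type_le c (mtype ?b) (mtype ?l) \<and> (mtype ?b = mtype ?l \<longrightarrow> mtype a = mtype l)"
  proof (cases "excess c (mtype ?b) < excess c (mtype ?l)")
    case True
    then show ?thesis by (auto simp: type_le_def)
  next
    case False
    with wb wl a(2) have eq: "excess c (mtype a) = excess c (mtype l)" "mtype a \<le> mtype l"
      "excess c (mtype ?b) = excess c (mtype ?l)" by (auto simp: type_le_def)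
    \<comment> \<open>With a decreasing left side, a lexicographic inequality \<open>m < ?l\<close>
      yields an inequality of types.\<close>
    define m where "m = sorted_monom (mtype ?b)"
    have m: "decr m" "mtype m = mtype ?b"
      by (simp_all add: m_def decr_sorted_monom mtype_sorted_monom zero_notin_mtype)
    have "card (keys ?b) \<le> card {..<n}" using kb by (intro card_mono) auto
    then have "keys m \<subseteq> {..<n}"
      by (auto simp: m_def keys_sorted_monom zero_notin_mtype size_mtype)
    from mtype_eq_permutes[OF finite_lessThan this kb m(2)]
    obtain p where p: "p permutes {..<n}" "\<And>i. lookup m i = lookup ?b (p i)" by blast
    have inj: "inj p" "bij p" using p(1) by (auto simp: permutes_inj permutes_bij)
    \<comment> \<open>The renaming of variables that sorts the sum is applied to both summands,
      which keeps their types. As \<open>l\<close> and \<open>ones {..<i}\<close> are decreasing,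
      each summand is lexicographically at most its counterpart, and so is the sum.\<close>
    define a' where "a' = Poly_Mapping.map_key p a"
    define S' where "S' = p -` S"
    have la': "lookup a' j = lookup a (p j)" for j
      unfolding a'_def using inj by (simp add: map_key.rep_eq)
    have S': "finite S'" "card S' = i"
      unfolding S'_def using inj finS S(2)
      by (auto simp: finite_vimageI card_vimage_inj bij_is_surj)
    have m_eq: "m = a' + ones S'"
      by (rule poly_mapping_eqI)
        (simp add: p(2) lookup_add la' lookup_ones[OF finS] lookup_ones[OF S'(1)], simp add: S'_def)
    have ta': "mtype a' = mtype a" by (rule mtype_permute[OF inj(2) la'])
    have le1: "a' \<le> l" using l(1) eq(2) ta' by (simp add: lex_le_of_mtype)
    have le2: "ones S' \<le> ones {..<i}"
      by (rule lex_le_of_mtype[OF decr_ones]) (simp add: mtype_ones S')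
    have le: "m \<le> ?l" unfolding m_eq by (rule add_mono[OF le1 le2])
    show ?thesis
    proof (cases "m = ?l")
      case True
      have "a' = l"
      proof (rule ccontr)
        assume "a' \<noteq> l"
        with le1 have "a' < l" by simp
        from add_less_le_mono[OF this le2] True m_eq show False by simp
      qed
      with ta' True m(2) show ?thesis by (auto simp: type_le_refl)
    next
      case False
      with le have "m < ?l" by simp
      from mtype_less_of_lex[OF m(1) this] m(2) eq(3) show ?thesis by (auto simp: type_le_def)
    qed
  qed
  then show "type_le c (mtype ?b) (mtype ?l)" "mtype ?b = mtype ?l \<Longrightarrow> mtype a = mtype l" by blast+
qed

section \<open>Leading types of an ideal\<close>

lemma mpoly_expand: "f = (\<Sum>m\<in>keys f. single m (lookup f m))" for f :: "'a::comm_ring_1 mpoly"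
proof (rule poly_mapping_eqI)
  fix m
  have "(\<Sum>k\<in>keys f. lookup (single k (lookup f k)) m) = (\<Sum>k\<in>keys f. if k = m then lookup f k else 0)"
    by (intro sum.cong) (auto simp: lookup_single when_def)
  then show "lookup f m = lookup (\<Sum>m\<in>keys f. single m (lookup f m)) m"
    by (simp add: lookup_sum in_keys_iff)
qed

text \<open>The linear functional with prescribed values on monomials. Type coordinates are of this
  form, even after multiplication by a monomial, so cancellations are handled without expanding
  products.\<close>

definition pairing :: "(monom \<Rightarrow> 'a) \<Rightarrow> 'a::comm_ring_1 mpoly \<Rightarrow> 'a" where
  "pairing \<gamma> f = (\<Sum>m\<in>keys f. lookup f m * \<gamma> m)"

lemma pairing_superset: "finite A \<Longrightarrow> keys f \<subseteq> A \<Longrightarrow> pairing \<gamma> f = (\<Sum>m\<in>A. lookup f m * \<gamma> m)"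
  unfolding pairing_def by (rule sum.mono_neutral_left) (auto simp: in_keys_iff)

lemma pairing_0 [simp]: "pairing \<gamma> 0 = 0" by (simp add: pairing_def)

lemma pairing_add: "pairing \<gamma> (f + g) = pairing \<gamma> f + pairing \<gamma> g"
proof -
  let ?A = "keys f \<union> keys g"
  have "pairing \<gamma> (f + g) = (\<Sum>m\<in>?A. lookup (f + g) m * \<gamma> m)"
    using keys_add[of f g] by (intro pairing_superset) auto
  then show ?thesis
    by (simp add: pairing_superset[of ?A] lookup_add algebra_simps sum.distrib)
qed

lemma pairing_sum: "pairing \<gamma> (\<Sum>i\<in>S. f i) = (\<Sum>i\<in>S. pairing \<gamma> (f i))"
  by (induction S rule: infinite_finite_induct) (auto simp: pairing_add)

lemma pairing_single [simp]: "pairing \<gamma> (single m c) = c * \<gamma> m"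
  by (auto simp: pairing_superset[of "{m}"])

lemma pairing_cong: "(\<And>m. m \<in> keys f \<Longrightarrow> \<gamma> m = \<delta> m) \<Longrightarrow> pairing \<gamma> f = pairing \<delta> f"
  by (simp add: pairing_def)

lemma pairing_mult_single: "pairing \<gamma> (f * single u c) = c * pairing (\<lambda>m. \<gamma> (m + u)) f"
proof -
  have "f * single u c = (\<Sum>m\<in>keys f. single (m + u) (lookup f m * c))"
    by (subst (1) mpoly_expand) (simp add: sum_distrib_right mult_single)
  then have "pairing \<gamma> (f * single u c) = (\<Sum>m\<in>keys f. lookup f m * c * \<gamma> (m + u))"
    by (simp only: pairing_sum pairing_single)
  then show ?thesis
    by (simp add: pairing_def sum_distrib_left mult_ac)
qed

text \<open>
  The values \<open>type_coeff f T\<close> are the coordinates of the image of \<open>f\<close> in the coinvariants of \<open>K[X]\<close>,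
  which have the types as a basis.
\<close>

definition type_coeff :: "'a::comm_ring_1 mpoly \<Rightarrow> nat multiset \<Rightarrow> 'a" where
  "type_coeff f T = pairing (\<lambda>m. of_bool (mtype m = T)) f"

lemma type_coeff_sum: "type_coeff (\<Sum>i\<in>S. f i) T = (\<Sum>i\<in>S. type_coeff (f i) T)" by (simp add: type_coeff_def pairing_sum)

lemma type_coeff_eq_0: "T \<notin> mtype ` keys f \<Longrightarrow> type_coeff f T = 0"
  by (auto simp: type_coeff_def pairing_def intro!: sum.neutral)

text \<open>A functional that depends on types only factors through the coinvariants.\<close>

lemma pairing_mtype: "pairing (\<lambda>m. \<gamma> (mtype m)) f = (\<Sum>T\<in>mtype ` keys f. \<gamma> T * type_coeff f T)"
proof -
  have "(\<Sum>T\<in>mtype ` keys f. \<gamma> T * type_coeff f T) =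
      (\<Sum>T\<in>mtype ` keys f. \<Sum>m\<in>keys f. if mtype m = T then lookup f m * \<gamma> (mtype m) else 0)"
    unfolding type_coeff_def pairing_def sum_distrib_left
    by (intro sum.cong refl) (auto simp: mult_ac)
  also have "\<dots> = (\<Sum>m\<in>keys f. \<Sum>T\<in>mtype ` keys f. if mtype m = T then lookup f m * \<gamma> (mtype m) else 0)"
    by (rule sum.swap)
  also have "\<dots> = pairing (\<lambda>m. \<gamma> (mtype m)) f"
    by (simp add: pairing_def)
  finally show ?thesis by simp
qed

lemma lookup_homogeneous_component:
  "lookup (homogeneous_component d f) m = (if monom_degree m = d then lookup f m else 0)"
proof -
  have "lookup (homogeneous_component d f) m =
      (\<Sum>k\<in>{k \<in> keys f. monom_degree k = d}. if k = m then lookup f k else 0)"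
    unfolding homogeneous_component_def lookup_sum
    by (intro sum.cong) (auto simp: lookup_single when_def)
  then show ?thesis by (simp add: in_keys_iff)
qed

lemma keys_homogeneous_component:
  "keys (homogeneous_component d f) = {m \<in> keys f. monom_degree m = d}"
  by (auto simp: in_keys_iff lookup_homogeneous_component split: if_splits)

lemma type_coeff_homogeneous_component:
  "type_coeff (homogeneous_component d f) T = (if sum_mset T = d then type_coeff f T else 0)"
proof -
  have "type_coeff (homogeneous_component d f) T =
      (\<Sum>m\<in>keys f. lookup (homogeneous_component d f) m * of_bool (mtype m = T))"
    unfolding type_coeff_def by (rule pairing_superset) (auto simp: keys_homogeneous_component)
  also have "\<dots> = (\<Sum>m\<in>keys f. if sum_mset T = d then lookup f m * of_bool (mtype m = T) else 0)"
    by (intro sum.cong) (auto simp: lookup_homogeneous_component sum_mset_mtype[symmetric])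
  also have "\<dots> = (if sum_mset T = d then type_coeff f T else 0)"
    by (simp add: type_coeff_def pairing_def)
  finally show ?thesis .
qed

locale KX_ideal =
  fixes I :: "'a::comm_ring_1 mpoly set"
  assumes I: "ideal I KX"
begin

lemma I_add: "f \<in> I \<Longrightarrow> g \<in> I \<Longrightarrow> f + g \<in> I"
  using additive_subgroup.a_closed[OF ideal.axioms(1)[OF I]] by simp

lemma I_mult: "f \<in> I \<Longrightarrow> f * g \<in> I"
  using ideal.I_r_closed[OF I] by simp

lemma I_zero: "0 \<in> I"
  using additive_subgroup.zero_closed[OF ideal.axioms(1)[OF I]] by simp

lemma I_uminus: "f \<in> I \<Longrightarrow> - f \<in> I"
  using I_mult[of f "-1"] by simp

lemma I_sum: "(\<And>i. i \<in> S \<Longrightarrow> f i \<in> I) \<Longrightarrow> (\<Sum>i\<in>S. f i) \<in> I"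
  by (induction S rule: infinite_finite_induct) (auto simp: I_zero I_add)

text \<open>
  The leading types of \<open>I\<close> in the coinvariants; the types outside \<open>leads c\<close> represent a basis of the
  coinvariants modulo the image of \<open>I\<close>.
\<close>

definition leads :: "nat \<Rightarrow> nat multiset set" where
  "leads c = {T. \<exists>f\<in>I. type_coeff f T \<noteq> 0 \<and> (\<forall>S. type_coeff f S \<noteq> 0 \<longrightarrow> type_le c S T)}"

lemma leadsI: "f \<in> I \<Longrightarrow> type_coeff f T \<noteq> 0 \<Longrightarrow> (\<And>S. type_coeff f S \<noteq> 0 \<Longrightarrow> type_le c S T) \<Longrightarrow> T \<in> leads c"
  by (auto simp: leads_def)

end

lemma keys_bound:
  assumes "finite (M :: monom set)"
  shows "\<exists>n\<ge>n0. \<forall>m\<in>M. keys m \<subseteq> {..<n}"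
proof -
  have "finite (\<Union>m\<in>M. keys m)" using assms by simp
  then obtain k where "\<forall>i\<in>(\<Union>m\<in>M. keys m). i < k" using finite_nat_set_iff_bounded by blast
  then show ?thesis by (intro exI[of _ "max n0 k"]) fastforce
qed

section \<open>Rows and columns: multiplications that carry leading types to leading types\<close>

context KX_ideal
begin

text \<open>A power of a fresh variable inserts \<open>j\<close> into all types at once. This is
  injective on types, so nothing cancels, and it preserves the order by
  \<open>type_le_add_mset\<close>.\<close>

lemma leads_row:
  assumes "T \<in> leads c" "j > 0"
  shows "add_mset j T \<in> leads c"
proof -
  obtain f where f: "f \<in> I" "type_coeff f T \<noteq> 0" "\<And>S. type_coeff f S \<noteq> 0 \<Longrightarrow> type_le c S T"
    using assms(1) by (auto simp: leads_def)
  obtain n where n: "\<forall>m\<in>keys f. keys m \<subseteq> {..<n}" using keys_bound[of "keys f" 0] by auto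
  define g where "g = f * single (single n j) 1"
  have tcg: "type_coeff g S = pairing (\<lambda>m. of_bool (add_mset j (mtype m) = S)) f" for S
  proof -
    have "mtype (m + single n j) = add_mset j (mtype m)" if "m \<in> keys f" for m
    proof -
      have "keys m \<inter> keys (single n j) = {}" using n that assms(2) by fastforce
      from mtype_add_disjoint[OF this] assms(2) show ?thesis by (simp add: mtype_single)
    qed
    then have "pairing (\<lambda>m. of_bool (mtype (m + single n j) = S)) f = pairing (\<lambda>m. of_bool (add_mset j (mtype m) = S)) f"
      by (intro pairing_cong) simp
    then show ?thesis by (simp add: type_coeff_def g_def pairing_mult_single)
  qed
  have type_coeff_add': "type_coeff g (add_mset j S) = type_coeff f S" for S unfolding tcg by (simp add: type_coeff_def)
  have type_coeff_no: "\<exists>S'. S = add_mset j S'" if "type_coeff g S \<noteq> 0" for S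
  proof (rule ccontr)
    assume "\<nexists>S'. S = add_mset j S'"
    then have "type_coeff g S = 0" unfolding tcg pairing_def by (intro sum.neutral) auto
    with that show False by simp
  qed
  show ?thesis
  proof (rule leadsI)
    show "g \<in> I" unfolding g_def by (rule I_mult[OF f(1)])
    show "type_coeff g (add_mset j T) \<noteq> 0" using f(2) by (simp add: type_coeff_add')
    fix S assume S: "type_coeff g S \<noteq> 0"
    then obtain S' where "S = add_mset j S'" using type_coeff_no by blast
    with S f(3)[of S'] show "type_le c S (add_mset j T)" by (simp add: type_coeff_add' type_le_add_mset)
  qed
qed

end

text \<open>A permutation that takes \<open>a\<close> to \<open>b\<close> matches the sets
  \<open>S\<close>. So multiplication by an elementary symmetric polynomial descends to a linear map
  in type coordinates.\<close>

lemma card_columns_mtype: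
  assumes "keys a \<subseteq> {..<n}" "keys b \<subseteq> {..<n}" "mtype a = mtype b"
  shows "card {S. S \<subseteq> {..<n} \<and> card S = i \<and> mtype (a + ones S) = U} =
         card {S. S \<subseteq> {..<n} \<and> card S = i \<and> mtype (b + ones S) = U}"
proof -
  obtain p where p: "p permutes {..<n}" "\<And>i. lookup a i = lookup b (p i)"
    using mtype_eq_permutes[OF finite_lessThan assms] by blast
  have bij: "bij p" "inj p" using p(1) by (auto simp: permutes_bij permutes_inj)
  have img: "p ` {..<n} = {..<n}" using p(1) by (rule permutes_image)
  have 1: "mtype (a + ones S) = mtype (b + ones (p ` S))" if "S \<subseteq> {..<n}" for S
  proof (rule mtype_permute[OF bij(1)])
    have "finite S" using that finite_subset by blast
    then show "lookup (a + ones S) i = lookup (b + ones (p ` S)) (p i)" for i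
      using bij(2) by (simp add: lookup_add lookup_ones p(2) inj_image_mem_iff)
  qed
  have 2: "p ` S \<subseteq> {..<n}" "card (p ` S) = card S" if "S \<subseteq> {..<n}" for S
    using that img bij(2) by (auto simp: card_image inj_on_subset[OF bij(2)])
  have 3: "\<exists>S. S \<subseteq> {..<n} \<and> S' = p ` S" if "S' \<subseteq> {..<n}" for S'
    using that img by (metis subset_image_iff)
  have "bij_betw (image p) {S. S \<subseteq> {..<n} \<and> card S = i \<and> mtype (a + ones S) = U}
      {S. S \<subseteq> {..<n} \<and> card S = i \<and> mtype (b + ones S) = U}"
  proof (intro bij_betw_imageI equalityI subsetI)
    show "inj_on ((`) p) {S. S \<subseteq> {..<n} \<and> card S = i \<and> mtype (a + ones S) = U}"
      using bij(2) by (auto simp: inj_on_def inj_image_eq_iff)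
    fix S' assume S': "S' \<in> {S. S \<subseteq> {..<n} \<and> card S = i \<and> mtype (b + ones S) = U}"
    then obtain S where "S \<subseteq> {..<n}" "S' = p ` S" using 3 by blast
    with S' 1[of S] 2[of S] show "S' \<in> (`) p ` {S. S \<subseteq> {..<n} \<and> card S = i \<and> mtype (a + ones S) = U}"
      by auto
  qed (use 1 2 in auto)
  then show ?thesis by (rule bij_betw_same_card)
qed

locale KX_ideal_char_0 = KX_ideal I for I :: "'a::field_char_0 mpoly set"
begin

text \<open>
  Multiply by the \<open>i\<close>-th elementary symmetric polynomial in all variables that occur. The multiplicity
  of the new leading term is a positive integer, hence nonzero in characteristic 0.
\<close>

lemma leads_column:
  assumes l: "decr l" "mtype l \<in> leads c" and i: "\<And>j. j < i \<Longrightarrow> c \<le> lookup l j"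
  shows "mtype (l + ones {..<i}) \<in> leads c"
proof -
  obtain f where f: "f \<in> I" "type_coeff f (mtype l) \<noteq> 0" "\<And>S. type_coeff f S \<noteq> 0 \<Longrightarrow> type_le c S (mtype l)"
    using l(2) by (auto simp: leads_def)
  obtain n where n: "i \<le> n" "keys l \<subseteq> {..<n}" "\<And>m. m \<in> keys f \<Longrightarrow> keys m \<subseteq> {..<n}"
    using keys_bound[of "insert l (keys f)" i] by auto
  let ?C = "{S. S \<subseteq> {..<n} \<and> card S = i}" and ?l = "l + ones {..<i}"
  have finC: "finite ?C" by (rule finite_subset[of _ "Pow {..<n}"]) auto
  define g where "g = f * (\<Sum>S\<in>?C. single (ones S) 1)"
  \<comment> \<open>The matrix of this multiplication in type coordinates, computed at the sorted
    representative of \<open>T\<close>; by \<open>card_columns_mtype\<close> any representative in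
    the first \<open>n\<close> variables gives the same number.\<close>
  define N where "N U T = card {S \<in> ?C. mtype (sorted_monom T + ones S) = U}" for U T
  have sorted_monom: "keys (sorted_monom T) \<subseteq> {..<n}" "mtype (sorted_monom T) = T" if T: "T \<in> mtype ` keys f" for T
  proof -
    obtain m where m: "m \<in> keys f" "T = mtype m" using T by blast
    have "card (keys m) \<le> card {..<n}" using n(3)[OF m(1)] by (intro card_mono) auto
    then show "keys (sorted_monom T) \<subseteq> {..<n}" "mtype (sorted_monom T) = T"
      using m by (auto simp: keys_sorted_monom mtype_sorted_monom zero_notin_mtype size_mtype)
  qed
  have tcg: "type_coeff g U = (\<Sum>T\<in>mtype ` keys f. of_nat (N U T) * type_coeff f T)" for U
  proof -
    have "type_coeff g U = (\<Sum>S\<in>?C. pairing (\<lambda>m. of_bool (mtype (m + ones S) = U)) f)"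
      by (simp add: g_def sum_distrib_left type_coeff_def pairing_sum pairing_mult_single)
    also have "\<dots> = (\<Sum>m\<in>keys f. \<Sum>S\<in>?C. lookup f m * of_bool (mtype (m + ones S) = U))"
      unfolding pairing_def by (rule sum.swap)
    also have "\<dots> = pairing (\<lambda>m. of_nat (N U (mtype m))) f"
      unfolding pairing_def
    proof (rule sum.cong)
      fix m assume m: "m \<in> keys f"
      have "card {S \<in> ?C. mtype (m + ones S) = U} = N U (mtype m)"
        unfolding N_def using card_columns_mtype[of m n "sorted_monom (mtype m)" i U] n(3)[OF m] sorted_monom[of "mtype m"] m
        by (simp add: conj_assoc)
      moreover have "(\<Sum>S\<in>?C. of_bool (mtype (m + ones S) = U)) = (of_nat (card {S \<in> ?C. mtype (m + ones S) = U}) :: 'a)"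
        using finC by (simp add: of_bool_def sum.If_cases Int_def)
      ultimately show "(\<Sum>S\<in>?C. lookup f m * of_bool (mtype (m + ones S) = U)) = lookup f m * of_nat (N U (mtype m))"
        by (simp add: sum_distrib_left[symmetric])
    qed simp
    also have "\<dots> = (\<Sum>T\<in>mtype ` keys f. of_nat (N U T) * type_coeff f T)" by (rule pairing_mtype)
    finally show ?thesis .
  qed
  \<comment> \<open>Every type reached is at most \<open>mtype ?l\<close>, and that one is reached
    from \<open>mtype l\<close> alone. Its coefficient in \<open>g\<close> is thus a matrix entry
    times the leading coefficient of \<open>f\<close>, without cancellation.\<close>
  have key: "type_le c U (mtype ?l)" "U = mtype ?l \<Longrightarrow> T = mtype l"
    if "T \<in> mtype ` keys f" "type_coeff f T \<noteq> 0" "N U T \<noteq> 0" for U T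
  proof -
    have "{S \<in> ?C. mtype (sorted_monom T + ones S) = U} \<noteq> {}" using that(3) unfolding N_def by (metis card.empty)
    then obtain S where S: "S \<subseteq> {..<n}" "card S = i" "mtype (sorted_monom T + ones S) = U" by blast
    have t: "type_le c (mtype (sorted_monom T)) (mtype l)" using f(3) that sorted_monom(2)[OF that(1)] by simp
    show "type_le c U (mtype ?l)"
      using column_monotone(1)[OF l(1) n(2,1) i sorted_monom(1)[OF that(1)] t S(1,2)] S(3) by simp
    show "T = mtype l" if "U = mtype ?l"
      using column_monotone(2)[OF l(1) n(2,1) i sorted_monom(1) t S(1,2)] S(3) \<open>T \<in> mtype ` keys f\<close> that sorted_monom(2)
      by simp
  qed
  have l_in: "mtype l \<in> mtype ` keys f" using f(2) type_coeff_eq_0 by blast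
  show ?thesis
  proof (rule leadsI)
    show "g \<in> I" unfolding g_def by (rule I_mult[OF f(1)])
    have "type_coeff g (mtype ?l) = (\<Sum>T\<in>{mtype l}. of_nat (N (mtype ?l) T) * type_coeff f T)"
      unfolding tcg
    proof (rule sum.mono_neutral_right)
      show "\<forall>T\<in>mtype ` keys f - {mtype l}. of_nat (N (mtype ?l) T) * type_coeff f T = 0"
      proof (intro ballI, rule ccontr)
        fix T assume T: "T \<in> mtype ` keys f - {mtype l}" "of_nat (N (mtype ?l) T) * type_coeff f T \<noteq> 0"
        then have "type_coeff f T \<noteq> 0" "N (mtype ?l) T \<noteq> 0" by (metis mult_zero_right, metis mult_zero_left of_nat_0)
        with T(1) key(2)[of T "mtype ?l"] show False by blast
      qed
    qed (use l_in in auto)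
    moreover have "N (mtype ?l) (mtype l) \<noteq> 0"
    proof -
      have "{..<i} \<in> {S \<in> ?C. mtype (sorted_monom (mtype l) + ones S) = mtype ?l}" using n(1) l(1) by (simp add: sorted_monom_mtype)
      moreover have "finite {S \<in> ?C. mtype (sorted_monom (mtype l) + ones S) = mtype ?l}" using finC by (rule finite_subset[rotated]) blast
      ultimately have "card {S \<in> ?C. mtype (sorted_monom (mtype l) + ones S) = mtype ?l} > 0" unfolding card_gt_0_iff by blast
      then show ?thesis unfolding N_def by (rule gr_implies_not0)
    qed
    ultimately show "type_coeff g (mtype ?l) \<noteq> 0" using f(2) by simp
    fix U assume "type_coeff g U \<noteq> 0"
    then obtain T where "T \<in> mtype ` keys f" "of_nat (N U T) * type_coeff f T \<noteq> 0"
      unfolding tcg by (meson sum.not_neutral_contains_not_neutral)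
    then show "type_le c U (mtype ?l)" using key(1)[of T U] by simp
  qed
qed

end

text \<open>
  Multiplication by a monomial on the support of \<open>m\<^sub>1\<close> raises all exponents of \<open>m\<^sub>1\<close> to \<open>C\<close>. Every other
  monomial of the same degree \<open>d\<close> has a variable outside this support; the exponents out there are at
  most \<open>d\<close> and do not count for \<open>excess d\<close>, so its type becomes smaller.
\<close>

lemma (in KX_ideal) dagger_leads:
  assumes "homogeneous_ideal I" "dagger I"
  shows "\<exists>c r C. C > 0 \<and> c \<le> C \<and> replicate_mset r C \<in> leads c"
proof -
  obtain f N co mo where f: "f \<in> I" "(N::nat) \<ge> 1"
      "f = (\<Sum>i=1..N. single (mo i) (co i))" "\<And>i. i \<in> {1..N} \<Longrightarrow> co i \<noteq> 0" "inj_on mo {1..N}"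
      "\<And>i. i \<in> {1..N} \<Longrightarrow> i \<noteq> 1 \<Longrightarrow> \<not> keys (mo i) \<subseteq> keys (mo 1)"
    using assms(2) unfolding dagger_def by blast
  define m1 where "m1 = mo 1"
  define d where "d = monom_degree m1"
  \<comment> \<open>The component of the degree of \<open>m1\<close> is still in \<open>I\<close>.
    Equal degrees are what forces every other monomial to have smaller total exponent on the support
    of \<open>m1\<close>.\<close>
  define h where "h = homogeneous_component d f"
  have hI: "h \<in> I" using assms(1) f(1) by (simp add: homogeneous_ideal_def h_def)
  have lf: "lookup f m = (\<Sum>i\<in>{1..N}. if mo i = m then co i else 0)" for m
    unfolding f(3) lookup_sum by (intro sum.cong) (auto simp: lookup_single when_def)
  have "lookup f m1 = (\<Sum>i\<in>{1..N}. if i = 1 then co i else 0)"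
    unfolding lf m1_def
  proof (rule sum.cong)
    fix i assume "i \<in> {1..N}"
    then have "mo i = mo 1 \<longleftrightarrow> i = 1" using f(2,5) by (simp add: inj_on_eq_iff)
    then show "(if mo i = mo 1 then co i else 0) = (if i = 1 then co i else 0)" by simp
  qed simp
  then have f1: "lookup f m1 \<noteq> 0" using f(2,4) by simp
  have m1: "m1 \<in> keys h" using f1 by (simp add: h_def in_keys_iff lookup_homogeneous_component d_def)
  have other: "\<not> keys m \<subseteq> keys m1" if m: "m \<in> keys h" "m \<noteq> m1" for m
  proof -
    have "m \<in> keys f" using m(1) by (auto simp: h_def keys_homogeneous_component)
    then have "(\<Sum>i\<in>{1..N}. if mo i = m then co i else 0) \<noteq> 0" by (simp add: in_keys_iff lf)
    then obtain i where "i \<in> {1..N}" "(if mo i = m then co i else 0) \<noteq> 0"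
      by (rule sum.not_neutral_contains_not_neutral)
    then have "i \<in> {1..N}" "mo i = m" by (auto split: if_splits)
    with f(6)[of i] m(2) show ?thesis by (auto simp: m1_def)
  qed
  define K where "K = keys m1"
  \<comment> \<open>Exponents of \<open>m1\<close> are at most \<open>d\<close>, so \<open>u\<close>
    has exponents of at least \<open>d + 1\<close> on \<open>K\<close>. After multiplication by
    \<open>u\<close> all exponents on \<open>K\<close> exceed the cut-off \<open>d\<close>, and the
    truncated subtraction in the excess is additive there.\<close>
  define C where "C = 2 * d + 1"
  define u where "u = (\<Sum>i\<in>K. single i (C - lookup m1 i))"
  have finK: "finite K" by (simp add: K_def)
  have lu: "lookup u i = (if i \<in> K then C - lookup m1 i else 0)" for i
    using finK by (simp add: u_def lookup_sum lookup_single when_def)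
  have deg: "monom_degree m = d" if "m \<in> keys h" for m
    using that by (auto simp: h_def keys_homogeneous_component)
  have degsum: "(\<Sum>i\<in>A. lookup m i) = d" if "m \<in> keys h" "finite A" "keys m \<subseteq> A" for m A
    using sum_mtype[of A m "\<lambda>x. x"] that deg by (simp add: sum_mset_mtype)
  have le_d: "lookup m i \<le> d" if "m \<in> keys h" for m i
  proof -
    have "lookup m i \<le> (\<Sum>i\<in>insert i (keys m). lookup m i)" by (rule member_le_sum) auto
    with degsum[OF that, of "insert i (keys m)"] show ?thesis by auto
  qed
  define g where "g = h * single u 1"
  define e where "e = (\<Sum>i\<in>K. C - lookup m1 i - d)"
  have excess: "excess d (mtype (m + u)) = (\<Sum>i\<in>K. lookup m i) + e" if m: "m \<in> keys h" for m
  proof -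
    let ?A = "keys m \<union> K"
    have "excess d (mtype (m + u)) = (\<Sum>i\<in>?A. lookup (m + u) i - d)"
      using keys_add[of m u] finK by (intro excess_mtype) (auto simp: in_keys_iff lu split: if_splits)
    also have "\<dots> = (\<Sum>i\<in>K. lookup (m + u) i - d)"
      using finK le_d[OF m] by (intro sum.mono_neutral_right) (auto simp: lookup_add lu)
    also have "\<dots> = (\<Sum>i\<in>K. lookup m i + (C - lookup m1 i - d))"
    proof (rule sum.cong)
      fix i assume "i \<in> K"
      then show "lookup (m + u) i - d = lookup m i + (C - lookup m1 i - d)"
        using le_d[OF m1, of i] by (simp add: lookup_add lu C_def)
    qed simp
    finally show ?thesis by (simp add: sum.distrib e_def)
  qed
  have excess_less: "excess d (mtype (m + u)) < excess d (mtype (m1 + u))" if m: "m \<in> keys h" "m \<noteq> m1" for m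
  proof -
    obtain i where i: "i \<in> keys m" "i \<notin> K" using other[OF m] by (auto simp: K_def)
    have "(\<Sum>i\<in>K. lookup m i) < (\<Sum>i\<in>keys m \<union> K. lookup m i)"
      using i finK by (intro sum_strict_mono2[of _ _ i]) (auto simp: in_keys_iff)
    also have "\<dots> = (\<Sum>i\<in>K. lookup m1 i)"
      using degsum[OF m(1), of "keys m \<union> K"] degsum[OF m1, of K] finK by (simp add: K_def)
    finally show ?thesis using excess[OF m(1)] excess[OF m1] by simp
  qed
  have t1: "mtype (m1 + u) = replicate_mset (card K) C"
  proof -
    have l: "lookup (m1 + u) i = (if i \<in> K then C else 0)" for i
      using le_d[OF m1, of i] by (auto simp: lookup_add lu C_def K_def in_keys_iff)
    have "keys (m1 + u) = K" by (auto simp: in_keys_iff l C_def split: if_splits)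
    then have "mtype (m1 + u) = image_mset (\<lambda>_. C) (mset_set K)"
      unfolding mtype_def using finK by (auto simp: l intro!: image_mset_cong)
    then show ?thesis by (simp add: image_mset_const_eq)
  qed
  have tcg: "type_coeff g T = pairing (\<lambda>m. of_bool (mtype (m + u) = T)) h" for T
    by (simp add: type_coeff_def g_def pairing_mult_single)
  have "replicate_mset (card K) C \<in> leads d"
  proof (rule leadsI)
    show "g \<in> I" unfolding g_def by (rule I_mult[OF hI])
    have "type_coeff g (mtype (m1 + u)) = (\<Sum>m\<in>{m1}. lookup h m * of_bool (mtype (m + u) = mtype (m1 + u)))"
      unfolding tcg pairing_def
    proof (rule sum.mono_neutral_right)
      show "\<forall>m\<in>keys h - {m1}. lookup h m * of_bool (mtype (m + u) = mtype (m1 + u)) = 0"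
      proof
        fix m assume "m \<in> keys h - {m1}"
        then have "mtype (m + u) \<noteq> mtype (m1 + u)" using excess_less[of m] by auto
        then show "lookup h m * of_bool (mtype (m + u) = mtype (m1 + u)) = 0" by simp
      qed
    qed (use m1 in auto)
    then show "type_coeff g (replicate_mset (card K) C) \<noteq> 0" using m1 by (simp add: t1 in_keys_iff)
    fix S assume "type_coeff g S \<noteq> 0"
    then obtain m where "m \<in> keys h" "lookup h m * of_bool (mtype (m + u) = S) \<noteq> 0"
      unfolding tcg pairing_def by (rule sum.not_neutral_contains_not_neutral)
    then have m: "m \<in> keys h" "mtype (m + u) = S" by (auto simp: of_bool_def split: if_splits)
    then show "type_le d S (replicate_mset (card K) C)"
      unfolding t1[symmetric] using excess_less[of m] by (cases "m = m1") (auto simp: type_le_def)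
  qed
  moreover have "C > 0" "d \<le> C" by (simp_all add: C_def)
  ultimately show ?thesis by blast
qed

section \<open>Counting the types that are not leading\<close>

definition parts :: "nat \<Rightarrow> nat multiset set" where
  "parts d = {T. 0 \<notin># T \<and> sum_mset T = d}"

text \<open>Encodes a decreasing vector by its gaps, the last one measured from \<open>C\<close>.
  One more unit in \<open>v k\<close> raises exactly the entries 0, ..., k, which is the operation
  of \<open>leads_column\<close>.\<close>

definition large :: "nat \<Rightarrow> nat \<Rightarrow> (nat \<Rightarrow> nat) \<Rightarrow> monom" where
  "large C s v = (\<Sum>i<s. single i (C + (\<Sum>k=i..<s. v k)))"

lemma lookup_large: "lookup (large C s v) i = (if i < s then C + (\<Sum>k=i..<s. v k) else 0)"
proof -
  have "lookup (large C s v) i = (\<Sum>j\<in>{..<s}. if j = i then C + (\<Sum>k=j..<s. v k) else 0)"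
    unfolding large_def lookup_sum by (intro sum.cong) (auto simp: lookup_single when_def)
  then show ?thesis by simp
qed

lemma keys_large: "C > 0 \<Longrightarrow> keys (large C s v) = {..<s}"
  by (auto simp: in_keys_iff lookup_large split: if_splits)

lemma decr_large: "decr (large C s v)"
  by (rule antimonoI) (auto simp: lookup_large intro!: sum_mono2)

lemma large_upd:
  assumes "k < s"
  shows "large C s (v(k := Suc (v k))) = large C s v + ones {..<Suc k}"
proof (rule poly_mapping_eqI)
  fix i
  have "(\<Sum>j=i..<s. (v(k := Suc (v k))) j) = (\<Sum>j=i..<s. v j + (if j = k then 1 else 0))"
    by (intro sum.cong) auto
  also have "\<dots> = (\<Sum>j=i..<s. v j) + (if i \<le> k then 1 else 0)"
    using assms by (simp add: sum.distrib)
  finally show "lookup (large C s (v(k := Suc (v k)))) i = lookup (large C s v + ones {..<Suc k}) i"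
    using assms by (simp add: lookup_large lookup_add lookup_ones del: fun_upd_apply)
qed

lemma large_ge: "x \<in># mtype (large C s v) \<Longrightarrow> C \<le> x"
  by (auto simp: mtype_def in_keys_iff lookup_large split: if_splits)

lemma size_mtype_large: "C > 0 \<Longrightarrow> size (mtype (large C s v)) = s"
  by (simp add: size_mtype keys_large)

lemma large_inject:
  assumes "large C s v = large C s w" "k < s"
  shows "v k = w k"
proof -
  have eq: "(\<Sum>j=i..<s. v j) = (\<Sum>j=i..<s. w j)" if "i < s" for i
    using assms(1) that lookup_large[of C s v i] lookup_large[of C s w i] by simp
  have 1: "(\<Sum>j=k..<s. u j) = u k + (\<Sum>j=Suc k..<s. u j)" for u :: "nat \<Rightarrow> nat"
    using assms(2) by (rule sum.atLeast_Suc_lessThan)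
  show ?thesis
  proof (cases "Suc k < s")
    case True
    then show ?thesis using eq[OF assms(2)] eq[OF True] 1[of v] 1[of w] by simp
  next
    case False
    then show ?thesis using eq[OF assms(2)] 1[of v] 1[of w] by simp
  qed
qed

lemma large_surj:
  assumes "\<And>x. x \<in># T \<Longrightarrow> C \<le> x" "C > 0" "size T = s"
  shows "\<exists>v. (\<forall>k\<ge>s. v k = 0) \<and> mtype (large C s v) = T"
proof -
  have 0: "0 \<notin># T" using assms(1)[of 0] assms(2) by auto
  \<comment> \<open>Continuing the entries by the value \<open>C\<close> makes the last gap a
    distance from \<open>C\<close>; the gaps then telescope to \<open>e i\<close>.\<close>
  define e where "e k = (if k < s then lookup (sorted_monom T) k else C)" for k
  define v where "v k = (if k < s then e k - e (Suc k) else 0)" for k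
  have ge: "C \<le> lookup (sorted_monom T) k" if "k < s" for k
  proof -
    have "lookup (sorted_monom T) k \<in># mtype (sorted_monom T)"
      using that assms(3) keys_sorted_monom[OF 0] by (simp add: mtype_def)
    then show ?thesis using assms(1) mtype_sorted_monom[OF 0] by simp
  qed
  have mono: "e (Suc k) \<le> e k" for k
    using decr_sorted_monom[of T] ge[of k] by (auto simp: e_def antimonoD)
  have tele: "C + (\<Sum>k=i..<s. v k) = e i" if "i \<le> s" for i
    using that
  proof (induction i rule: inc_induct)
    case base
    show ?case by (simp add: e_def)
  next
    case (step i)
    have "(\<Sum>k=i..<s. v k) = v i + (\<Sum>k=Suc i..<s. v k)"
      using step.hyps by (intro sum.atLeast_Suc_lessThan) simp
    then have "C + (\<Sum>k=i..<s. v k) = v i + e (Suc i)" using step.IH by simp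
    also have "\<dots> = e i" using mono[of i] step.hyps by (simp add: v_def)
    finally show ?case .
  qed
  have "large C s v = sorted_monom T"
  proof (rule poly_mapping_eqI)
    fix i show "lookup (large C s v) i = lookup (sorted_monom T) i"
      using tele[of i] assms(3) by (auto simp: lookup_large e_def lookup_sorted_monom)
  qed
  then show ?thesis using mtype_sorted_monom[OF 0] by (intro exI[of _ v]) (simp add: v_def)
qed

definition small :: "nat \<Rightarrow> (nat \<Rightarrow> nat) \<Rightarrow> nat multiset" where
  "small C v = (\<Sum>j=1..<C. replicate_mset (v j) j)"

lemma count_small: "count (small C v) j = (if j \<in> {1..<C} then v j else 0)"
proof -
  have "count (small C v) j = (\<Sum>i\<in>{1..<C}. if i = j then v i else 0)"
    unfolding small_def count_sum by (intro sum.cong) auto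
  then show ?thesis by simp
qed

lemma set_small: "set_mset (small C v) \<subseteq> {1..<C}"
proof
  fix x assume "x \<in># small C v"
  then have "count (small C v) x > 0" by simp
  then show "x \<in> {1..<C}" by (simp only: count_small split: if_splits)
qed

lemma small_upd:
  assumes "j \<in> {1..<C}"
  shows "small C (v(j := Suc (v j))) = add_mset j (small C v)"
  using assms by (intro multiset_eqI) (auto simp: count_small)

lemma sum_mset_sum: "sum_mset (\<Sum>j\<in>S. f j) = (\<Sum>j\<in>S. sum_mset (f j))"
  by (induction S rule: infinite_finite_induct) auto

lemma sum_small: "sum_mset (small C v) = (\<Sum>j=1..<C. j * v j)"
  by (simp add: small_def sum_mset_sum mult.commute)

text \<open>A partition of \<open>d\<close> is determined by its multiplicities, which form an
  exponent vector of weighted degree \<open>d\<close> on the coordinates 1, ..., d.\<close>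

lemma finite_parts: "finite (parts d)"
proof -
  have "count ` parts d \<subseteq> exps_of_degree {1..<Suc d} (\<lambda>j. j) d"
  proof
    fix u assume "u \<in> count ` parts d"
    then obtain T where T: "0 \<notin># T" "sum_mset T = d" "u = count T" by (auto simp: parts_def)
    have out: "count T x = 0" if "x \<notin> {1..<Suc d}" for x
    proof (rule ccontr)
      assume "count T x \<noteq> 0"
      then have x: "x \<in># T" by simp
      then obtain T' where "T = add_mset x T'" by (meson multi_member_split)
      with T(2) have "x \<le> d" by auto
      moreover have "x \<noteq> 0" using x T(1) by metis
      ultimately show False using that by simp
    qed
    have "T = small (Suc d) (count T)"
      using out by (intro multiset_eqI) (simp add: count_small)
    then have "(\<Sum>x\<in>{1..<Suc d}. x * count T x) = d" using T(2) by (metis sum_small)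
    with out show "u \<in> exps_of_degree {1..<Suc d} (\<lambda>j. j) d" by (simp add: exps_of_degree_def T(3))
  qed
  moreover have "finite (exps_of_degree {1..<Suc d} (\<lambda>j. j) d)" by (intro finite_exps_of_degree) auto
  ultimately have "finite (count ` parts d)" by (rule finite_subset)
  then show ?thesis by (rule finite_imageD) (simp add: inj_on_def count_inject)
qed

text \<open>Makes room for the \<open>s\<close> variables of \<open>large C s v\<close>, so that the
  two supports are disjoint and types add.\<close>

definition shift :: "nat \<Rightarrow> monom \<Rightarrow> monom" where
  "shift s m = (\<Sum>i\<in>keys m. single (s + i) (lookup m i))"

lemma lookup_shift: "lookup (shift s m) k = (if s \<le> k then lookup m (k - s) else 0)"
proof -
  have "lookup (shift s m) k = (\<Sum>i\<in>keys m. if i = k - s then (if s \<le> k then lookup m i else 0) else 0)"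
    unfolding shift_def lookup_sum by (intro sum.cong) (auto simp: lookup_single when_def)
  then show ?thesis by (simp add: in_keys_iff)
qed

lemma mtype_shift: "mtype (shift s m) = mtype m"
proof (rule multiset_eqI)
  fix v show "count (mtype (shift s m)) v = count (mtype m) v"
  proof (cases "v = 0")
    case False
    have "{i. lookup (shift s m) i = v} = (+) s ` {i. lookup m i = v}"
    proof (intro equalityI subsetI)
      fix i assume "i \<in> {i. lookup (shift s m) i = v}"
      with False have "s \<le> i" "lookup m (i - s) = v" by (auto simp: lookup_shift split: if_splits)
      then show "i \<in> (+) s ` {i. lookup m i = v}" by (intro image_eqI[of _ _ "i - s"]) auto
    qed (auto simp: lookup_shift)
    then show ?thesis using False by (simp add: count_mtype card_image)
  qed (simp add: count_mtype)
qed

text \<open>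
  \<open>glue C s\<close> parametrises the types with exactly \<open>s\<close> entries \<open>\<ge> C\<close>: the left coordinates are the
  multiplicities of the entries below \<open>C\<close>, the right ones the gaps between the large entries.
\<close>

definition glue :: "nat \<Rightarrow> nat \<Rightarrow> (nat + nat \<Rightarrow> nat) \<Rightarrow> nat multiset" where
  "glue C s u = small C (u \<circ> Inl) + mtype (large C s (u \<circ> Inr))"

lemma glue_cong:
  assumes "\<And>x. x \<in> {1..<C} <+> {..<s} \<Longrightarrow> u x = u' x"
  shows "glue C s u = glue C s u'"
proof -
  have "small C (u \<circ> Inl) = small C (u' \<circ> Inl)"
    using assms[OF InlI] by (intro multiset_eqI) (simp add: count_small)
  moreover have "large C s (u \<circ> Inr) = large C s (u' \<circ> Inr)"
    using assms[OF InrI] by (intro poly_mapping_eqI) (auto simp: lookup_large intro!: sum.cong)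
  ultimately show ?thesis by (simp add: glue_def)
qed

lemma zero_notin_glue: "0 \<notin># glue C s u"
  using zero_notin_mtype set_small[of C "u \<circ> Inl"] by (auto simp: glue_def)

section \<open>Leading types in the coordinates of \<open>glue\<close>\<close>

context KX_ideal_char_0
begin

text \<open>A unit in a left coordinate inserts a small entry, which is a row. A unit in the right
  coordinate \<open>k\<close> raises the \<open>k + 1\<close> largest entries, all at least
  \<open>C\<close> and hence at least \<open>c\<close>, which is a column.\<close>

lemma leads_glue_step:
  assumes "glue C s u \<in> leads c" "c \<le> C" "C > 0" "x \<in> {1..<C} <+> {..<s}"
  shows "glue C s (u(x := Suc (u x))) \<in> leads c"
proof (cases x)
  case (Inl j)
  then have j: "j \<in> {1..<C}" using assms(4) by auto
  have "u(x := Suc (u x)) \<circ> Inl = (u \<circ> Inl)(j := Suc ((u \<circ> Inl) j))"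
    "u(x := Suc (u x)) \<circ> Inr = u \<circ> Inr" using Inl by auto
  then have "glue C s (u(x := Suc (u x))) = add_mset j (glue C s u)"
    by (simp only: glue_def small_upd[OF j]) simp
  with leads_row[OF assms(1), of j] j show ?thesis by simp
next
  case (Inr k)
  then have k: "k < s" using assms(4) by auto
  define L where "L = large C s (u \<circ> Inr)"
  \<comment> \<open>The small entries are placed behind the \<open>s\<close> large ones, so that
    \<open>L + t\<close> is decreasing, as \<open>leads_column\<close> demands.\<close>
  define t where "t = shift s (sorted_monom (small C (u \<circ> Inl)))"
  have 0: "0 \<notin># small C (u \<circ> Inl)" using set_small[of C "u \<circ> Inl"] by auto
  have t: "mtype t = small C (u \<circ> Inl)" unfolding t_def mtype_shift using 0 by (rule mtype_sorted_monom)
  have t_less: "lookup t i < C" for i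
  proof (cases "lookup t i = 0")
    case False
    then have "lookup t i \<in># mtype t" by (simp add: mtype_def in_keys_iff)
    then show ?thesis unfolding t using set_small[of C "u \<circ> Inl"] by auto
  qed (use assms(3) in simp)
  have t_0: "lookup t i = 0" if "i < s" for i using that by (simp add: t_def lookup_shift)
  have kt: "keys t \<inter> {..<s} = {}" using t_0 by (auto simp: in_keys_iff)
  have kL: "keys L = {..<s}" unfolding L_def using assms(3) by (rule keys_large)
  have decr: "decr (L + t)"
  proof (rule antimonoI)
    fix i j :: nat assume "i \<le> j"
    consider "j < s" | "i < s" "s \<le> j" | "s \<le> i" by linarith
    then show "lookup (L + t) j \<le> lookup (L + t) i"
    proof cases
      case 1
      then show ?thesis using \<open>i \<le> j\<close> decr_large[of C s "u \<circ> Inr"]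
        by (simp add: lookup_add t_0 L_def antimonoD)
    next
      case 2
      have "lookup (L + t) j = lookup t j" using 2 by (simp add: L_def lookup_add lookup_large)
      also have "\<dots> \<le> C" using t_less[of j] by simp
      also have "\<dots> \<le> lookup (L + t) i" using 2 by (simp add: L_def lookup_add lookup_large)
      finally show ?thesis .
    next
      case 3
      then show ?thesis using \<open>i \<le> j\<close> decr_sorted_monom[of "small C (u \<circ> Inl)"]
        by (simp add: lookup_add L_def lookup_large t_def lookup_shift antimonoD)
    qed
  qed
  have "mtype (L + t) = glue C s u"
    using kt kL by (subst mtype_add_disjoint) (auto simp: t glue_def L_def)
  then have "mtype (L + t + ones {..<Suc k}) \<in> leads c"
    using assms(1,2) k by (intro leads_column decr) (auto simp: lookup_add L_def lookup_large)
  also have "L + t + ones {..<Suc k} = large C s ((u \<circ> Inr)(k := Suc ((u \<circ> Inr) k))) + t"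
    using large_upd[OF k, of C "u \<circ> Inr"] by (simp add: L_def add_ac)
  also have "mtype \<dots> = glue C s (u(x := Suc (u x)))"
  proof -
    have "u(x := Suc (u x)) \<circ> Inr = (u \<circ> Inr)(k := Suc ((u \<circ> Inr) k))"
      "u(x := Suc (u x)) \<circ> Inl = u \<circ> Inl" using Inr by auto
    then show ?thesis
      using kt keys_large[OF assms(3)] by (subst mtype_add_disjoint) (auto simp: t glue_def)
  qed
  finally show ?thesis .
qed

text \<open>The walk from \<open>u\<close> to \<open>u'\<close> takes one unit at a time. In
  contrapositive form the nonleading parameter vectors are down-closed, as
  \<open>gen_fun_rational\<close> requires.\<close>

lemma leads_glue_mono:
  assumes "glue C s u \<in> leads c" "c \<le> C" "C > 0" "u \<le> u'"
  shows "glue C s u' \<in> leads c"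
  using assms(1,4)
proof (induction "\<Sum>x\<in>{1..<C} <+> {..<s}. u' x - u x" arbitrary: u rule: less_induct)
  case less
  let ?A = "{1..<C} <+> {..<s}"
  show ?case
  proof (cases "\<forall>x\<in>?A. u x = u' x")
    case True
    then have "glue C s u = glue C s u'" by (intro glue_cong) blast
    with less.prems show ?thesis by simp
  next
    case False
    then obtain x where x: "x \<in> ?A" "u x \<noteq> u' x" by blast
    with less.prems(2) have lt: "u x < u' x" by (simp add: le_fun_def le_neq_implies_less)
    let ?u = "u(x := Suc (u x))"
    have "(\<Sum>x\<in>?A. u' x - ?u x) < (\<Sum>x\<in>?A. u' x - u x)"
      using lt x(1) by (intro sum_strict_mono_ex1 bexI[of _ x]) auto
    moreover have "?u \<le> u'" using less.prems(2) lt by (auto simp: le_fun_def)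
    ultimately show ?thesis
      using less.hyps leads_glue_step[OF less.prems(1) assms(2,3) x(1)] by blast
  qed
qed

lemma leads_add: "T \<in> leads c \<Longrightarrow> 0 \<notin># U \<Longrightarrow> T + U \<in> leads c"
  by (induction U) (auto intro: leads_row)

text \<open>Any \<open>r\<close> entries that are at least \<open>C\<close> arise from
  \<open>r\<close> copies of \<open>C\<close> by raising gaps; the remaining entries of
  \<open>T\<close> are inserted as rows.\<close>

lemma leads_many_large:
  assumes r: "replicate_mset r C \<in> leads c" "c \<le> C" "C > 0"
    and T: "0 \<notin># T" "r \<le> size (filter_mset (\<lambda>x. C \<le> x) T)"
  shows "T \<in> leads c"
proof -
  obtain xs where xs: "mset xs = filter_mset (\<lambda>x. C \<le> x) T" using ex_mset by blast
  define R where "R = mset (take r xs)"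
  have "R \<subseteq># mset xs" unfolding R_def
    by (metis append_take_drop_id mset_append mset_subset_eq_add_left)
  then have R: "R \<subseteq># filter_mset (\<lambda>x. C \<le> x) T" unfolding xs .
  then have "R \<subseteq># T" using multiset_filter_subset subset_mset.order_trans by blast
  have "length xs = size (filter_mset (\<lambda>x. C \<le> x) T)" using xs by (metis size_mset)
  then have size: "size R = r" using T(2) by (simp add: R_def)
  have "C \<le> x" if "x \<in># R" for x using mset_subset_eqD[OF R that] by simp
  from large_surj[OF this r(3) size] obtain v where v: "mtype (large C r v) = R" by blast
  have glue0: "glue C r (case_sum (\<lambda>_. 0) w) = mtype (large C r w)" for w
  proof -
    have "small C (\<lambda>_. 0) = {#}" by (intro multiset_eqI) (simp add: count_small)
    then show ?thesis by (simp add: glue_def comp_def)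
  qed
  have "mtype (large C r (\<lambda>_. 0)) = image_mset (\<lambda>_. C) (mset_set {..<r})"
    unfolding mtype_def keys_large[OF r(3)] by (intro image_mset_cong) (simp add: lookup_large)
  then have "glue C r (case_sum (\<lambda>_. 0) (\<lambda>_. 0)) \<in> leads c"
    using r(1) glue0[of "\<lambda>_. 0"] by (simp only: image_mset_const_eq) simp
  then have "glue C r (case_sum (\<lambda>_. 0) v) \<in> leads c"
    using r(2,3) by (rule leads_glue_mono) (auto simp: le_fun_def split: sum.split)
  then have "R \<in> leads c" by (simp add: glue0 v)
  then have "R + (T - R) \<in> leads c"
    using T(1) by (intro leads_add) (auto dest: in_diffD)
  then show ?thesis using \<open>R \<subseteq># T\<close> by simp
qed

end

text \<open>Gap \<open>k\<close> is part of each of the entries 0, ..., k, whence its weight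
  \<open>Suc k\<close>.\<close>

lemma sum_large: "C > 0 \<Longrightarrow> sum_mset (mtype (large C s v)) = s * C + (\<Sum>k<s. Suc k * v k)"
proof -
  assume C: "C > 0"
  have 1: "(\<Sum>i<s. \<Sum>k=i..<s. v k) = (\<Sum>k<s. Suc k * v k)"
  proof (induction s)
    case (Suc s)
    have "(\<Sum>i<s. \<Sum>k=i..<Suc s. v k) = (\<Sum>i<s. (\<Sum>k=i..<s. v k) + v s)"
      by (intro sum.cong) auto
    then show ?case using Suc by (simp add: sum.distrib)
  qed simp
  have "sum_mset (mtype (large C s v)) = (\<Sum>i<s. lookup (large C s v) i)"
    using sum_mtype[of "{..<s}" "large C s v" "\<lambda>x. x"] keys_large[OF C] by simp
  also have "\<dots> = s * C + (\<Sum>i<s. \<Sum>k=i..<s. v k)" by (simp add: lookup_large sum.distrib)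
  finally show ?thesis using 1 by simp
qed

lemma sum_glue:
  assumes "C > 0"
  shows "sum_mset (glue C s u) = s * C + (\<Sum>x\<in>{1..<C} <+> {..<s}. case_sum (\<lambda>j. j) Suc x * u x)"
  using assms by (simp add: glue_def sum_small sum_large sum.Plus comp_def)

text \<open>Cutting a type at \<open>C\<close> recovers the two halves of the parametrisation, which
  gives the injectivity of \<open>glue\<close>.\<close>

lemma filter_glue:
  "filter_mset (\<lambda>x. C \<le> x) (glue C s u) = mtype (large C s (u \<circ> Inr))"
  "filter_mset (\<lambda>x. \<not> C \<le> x) (glue C s u) = small C (u \<circ> Inl)"
proof -
  have all: "filter_mset Q M = M" if "\<And>x. x \<in># M \<Longrightarrow> Q x" for Q and M :: "nat multiset"
    using that by (induction M) auto
  have none: "filter_mset Q M = {#}" if "\<And>x. x \<in># M \<Longrightarrow> \<not> Q x" for Q and M :: "nat multiset"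
    using that by (induction M) auto
  have 1: "C \<le> x" if "x \<in># mtype (large C s (u \<circ> Inr))" for x using that by (rule large_ge)
  have 2: "\<not> C \<le> x" if "x \<in># small C (u \<circ> Inl)" for x
    using that set_small[of C "u \<circ> Inl"] by auto
  show "filter_mset (\<lambda>x. C \<le> x) (glue C s u) = mtype (large C s (u \<circ> Inr))"
    using all[OF 1] none[OF 2] by (simp add: glue_def)
  show "filter_mset (\<lambda>x. \<not> C \<le> x) (glue C s u) = small C (u \<circ> Inl)"
    using all[OF 2] none[of "mtype (large C s (u \<circ> Inr))" "\<lambda>x. \<not> C \<le> x"] 1 by (simp add: glue_def)
qed

lemma bij_betw_glue:
  assumes C: "C > 0"
  shows "bij_betw (glue C s) (exps_of_degree ({1..<C} <+> {..<s}) (case_sum (\<lambda>j. j) Suc) d)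
    {T \<in> parts (s * C + d). size (filter_mset (\<lambda>x. C \<le> x) T) = s}"
    (is "bij_betw _ ?V ?T")
proof (intro bij_betw_imageI equalityI subsetI)
  show "inj_on (glue C s) ?V"
  proof (rule inj_onI, rule ext)
    fix u u' x assume u: "u \<in> ?V" "u' \<in> ?V" and eq: "glue C s u = glue C s u'"
    have "mtype (large C s (u \<circ> Inr)) = mtype (large C s (u' \<circ> Inr))"
      using filter_glue(1)[of C s u] filter_glue(1)[of C s u'] eq by simp
    then have large: "large C s (u \<circ> Inr) = large C s (u' \<circ> Inr)"
      by (intro decr_mtype_inject decr_large)
    have small: "small C (u \<circ> Inl) = small C (u' \<circ> Inl)"
      using filter_glue(2)[of C s u] filter_glue(2)[of C s u'] eq by simp
    show "u x = u' x"
    proof (cases "x \<in> {1..<C} <+> {..<s}")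
      case True
      show ?thesis
      proof (cases x)
        case (Inl j)
        then have "j \<in> {1..<C}" using True by auto
        then show ?thesis using count_small[of C "u \<circ> Inl" j] count_small[of C "u' \<circ> Inl" j] small Inl
          by simp
      next
        case (Inr k)
        then have "k < s" using True by auto
        from large_inject[OF large this] Inr show ?thesis by simp
      qed
    next
      case False
      then show ?thesis using u by (simp add: exps_of_degree_def)
    qed
  qed
next
  fix T assume "T \<in> glue C s ` ?V"
  then obtain u where "u \<in> ?V" "T = glue C s u" by blast
  then show "T \<in> ?T" using C
    by (simp add: parts_def sum_glue zero_notin_glue filter_glue size_mtype_large exps_of_degree_def)
next
  fix T assume T: "T \<in> ?T"
  then have "size (filter_mset (\<lambda>x. C \<le> x) T) = s" by simp
  from large_surj[OF _ C this] obtain v where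
    v: "\<forall>k\<ge>s. v k = 0" "mtype (large C s v) = filter_mset (\<lambda>x. C \<le> x) T" by auto
  define u where "u = case_sum (\<lambda>j. if j \<in> {1..<C} then count T j else 0) v"
  have "small C (u \<circ> Inl) = filter_mset (\<lambda>x. \<not> C \<le> x) T"
  proof (rule multiset_eqI)
    fix j
    have "count T 0 = 0" using T by (simp add: parts_def not_in_iff)
    then show "count (small C (u \<circ> Inl)) j = count (filter_mset (\<lambda>x. \<not> C \<le> x) T) j"
      by (cases "j = 0") (auto simp: count_small u_def)
  qed
  moreover have "u \<circ> Inr = v" by (auto simp: u_def)
  ultimately have glue: "glue C s u = T"
    using v(2) multiset_partition[of T "\<lambda>x. C \<le> x"] by (simp add: glue_def add.commute)
  have "u \<in> ?V" unfolding exps_of_degree_def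
  proof (intro CollectI conjI allI impI)
    fix x assume "x \<notin> {1..<C} <+> {..<s}"
    then show "u x = 0"
    proof (cases x)
      case (Inr k)
      with \<open>x \<notin> {1..<C} <+> {..<s}\<close> have "s \<le> k" by (metis InrI lessThan_iff not_le_imp_less)
      with v(1) Inr show ?thesis by (simp add: u_def)
    qed (auto simp: u_def)
  next
    show "(\<Sum>x\<in>{1..<C} <+> {..<s}. case_sum (\<lambda>j. j) Suc x * u x) = d"
      using sum_glue[OF C, of s u] glue T by (simp add: parts_def)
  qed
  with glue show "T \<in> glue C s ` ?V" by blast
qed

lemma (in KX_ideal_char_0) nonleads_rational:
  assumes r: "replicate_mset r C \<in> leads c" "c \<le> C" "C > 0"
  shows "fps_rat (Abs_fps (\<lambda>d. of_nat (card (parts d - leads c))))"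
proof -
  define A where "A s = {1..<C} <+> {..<s}" for s :: nat
  define g :: "nat + nat \<Rightarrow> nat" where "g = case_sum (\<lambda>j. j) Suc"
  define P where "P s = {u. glue C s u \<notin> leads c}" for s
  define X where "X s d = {T \<in> parts d - leads c. size (filter_mset (\<lambda>x. C \<le> x) T) = s}" for s d
  \<comment> \<open>The \<open>s\<close> large entries alone use up degree \<open>s * C\<close>. The
    case distinction guards the subtraction and is the coefficient rule for the factor
    \<open>fps_X ^ (s * C)\<close>.\<close>
  have card_X: "card (X s d) = (if d < s * C then 0 else card (P s \<inter> exps_of_degree (A s) g (d - s * C)))" for s d
  proof (cases "d < s * C")
    case True
    have "X s d = {}"
    proof (rule ccontr)
      assume "X s d \<noteq> {}"
      then obtain T where T: "T \<in> parts d" "size (filter_mset (\<lambda>x. C \<le> x) T) = s" by (auto simp: X_def)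
      from large_surj[OF _ r(3) T(2)] obtain v where "mtype (large C s v) = filter_mset (\<lambda>x. C \<le> x) T" by auto
      then have "s * C \<le> sum_mset (filter_mset (\<lambda>x. C \<le> x) T)" using sum_large[OF r(3), of s v] by simp
      also have "\<dots> \<le> sum_mset T" by (metis le_add1 multiset_partition sum_mset.union)
      finally show False using T(1) True by (simp add: parts_def)
    qed
    with True show ?thesis by simp
  next
    case False
    let ?V = "exps_of_degree (A s) g (d - s * C)"
    have bij: "bij_betw (glue C s) ?V {T \<in> parts d. size (filter_mset (\<lambda>x. C \<le> x) T) = s}"
      using bij_betw_glue[OF r(3), of s "d - s * C"] False by (simp add: A_def g_def)
    have "glue C s ` (P s \<inter> ?V) = X s d"
    proof (intro equalityI subsetI)
      fix T assume T: "T \<in> X s d"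
      then have "T \<in> glue C s ` ?V" using bij_betw_imp_surj_on[OF bij] by (simp add: X_def)
      then obtain u where "u \<in> ?V" "T = glue C s u" by blast
      with T show "T \<in> glue C s ` (P s \<inter> ?V)" by (simp add: P_def X_def)
    qed (use bij_betw_imp_surj_on[OF bij] in \<open>auto simp: P_def X_def\<close>)
    then have "bij_betw (glue C s) (P s \<inter> ?V) (X s d)"
      using bij by (intro bij_betw_subset[OF bij]) auto
    from bij_betw_same_card[OF this] False show ?thesis by simp
  qed
  have dec: "down_closed (P s)" for s
    unfolding down_closed_def P_def using leads_glue_mono[OF _ r(2,3)] by blast
  have "card (parts d - leads c) = (\<Sum>s<r. card (X s d))" for d
  proof -
    have "size (filter_mset (\<lambda>x. C \<le> x) T) < r" if "T \<in> parts d - leads c" for T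
      using leads_many_large[OF r, of T] that by (force simp: parts_def)
    then have "parts d - leads c = (\<Union>s<r. X s d)" by (auto simp: X_def)
    moreover have "card (\<Union>s<r. X s d) = (\<Sum>s<r. card (X s d))"
      using finite_parts[of d] by (intro card_UN_disjoint) (auto simp: X_def)
    ultimately show ?thesis by simp
  qed
  then have "Abs_fps (\<lambda>d. of_nat (card (parts d - leads c))) = (\<Sum>s<r. fps_X ^ (s * C) * gen_fun (A s) g (P s))"
    by (intro fps_ext) (simp add: fps_sum_nth fps_X_power_mult_nth gen_fun_def card_X if_distrib cong: if_cong)
  moreover have "fps_rat (\<Sum>s<r. fps_X ^ (s * C) * gen_fun (A s) g (P s))"
  proof (intro fps_rat_sum fps_rat_X_power_mult gen_fun_rational dec)
    show "finite (A s)" for s by (simp add: A_def)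
    show "g i > 0" if "i \<in> A s" for i s using that by (auto simp: A_def g_def)
  qed
  ultimately show ?thesis by simp
qed

section \<open>The Reynolds operator\<close>

abbreviation pinv :: "(nat \<Rightarrow> nat) \<Rightarrow> nat \<Rightarrow> nat" where "pinv \<equiv> inv_into UNIV"

lemma lookup_act_monom: "bij \<sigma> \<Longrightarrow> lookup (act_monom \<sigma> m) k = lookup m (pinv \<sigma> k)"
proof -
  assume \<sigma>: "bij \<sigma>"
  have "lookup (act_monom \<sigma> m) k = (\<Sum>i\<in>keys m. if i = pinv \<sigma> k then lookup m i else 0)"
    unfolding act_monom_def lookup_sum
  proof (rule sum.cong)
    fix i
    have "\<sigma> i = k \<longleftrightarrow> i = pinv \<sigma> k" using \<sigma> by (rule bij_inv_eq_iff[symmetric])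
    then show "lookup (single (\<sigma> i) (lookup m i)) k = (if i = pinv \<sigma> k then lookup m i else 0)"
      by (simp add: lookup_single when_def)
  qed simp
  then show ?thesis by (simp add: in_keys_iff)
qed

lemma mtype_act_monom: "bij \<sigma> \<Longrightarrow> mtype (act_monom \<sigma> m) = mtype m"
  by (rule mtype_permute[of "pinv \<sigma>"]) (auto simp: lookup_act_monom bij_imp_bij_inv)

lemma act_monom_inverse:
  assumes "bij \<sigma>"
  shows "act_monom \<sigma> (act_monom (pinv \<sigma>) m) = m" "act_monom (pinv \<sigma>) (act_monom \<sigma> m) = m"
  using assms by (auto intro!: poly_mapping_eqI
      simp: lookup_act_monom bij_imp_bij_inv inv_inv_eq bij_is_surj surj_f_inv_f bij_is_inj)

lemma lookup_act: "bij \<sigma> \<Longrightarrow> lookup (act \<sigma> f) k = lookup f (act_monom (pinv \<sigma>) k)"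
proof -
  assume \<sigma>: "bij \<sigma>"
  have "lookup (act \<sigma> f) k = (\<Sum>m\<in>keys f. if m = act_monom (pinv \<sigma>) k then lookup f m else 0)"
    unfolding act_def lookup_sum
  proof (rule sum.cong)
    fix m
    have "act_monom \<sigma> m = k \<longleftrightarrow> m = act_monom (pinv \<sigma>) k"
      using act_monom_inverse[OF \<sigma>] by metis
    then show "lookup (single (act_monom \<sigma> m) (lookup f m)) k =
        (if m = act_monom (pinv \<sigma>) k then lookup f m else 0)"
      by (simp add: lookup_single when_def)
  qed simp
  then show ?thesis by (simp add: in_keys_iff)
qed

lemma act_add: "bij \<sigma> \<Longrightarrow> act \<sigma> (f + g) = act \<sigma> f + act \<sigma> g"
  by (intro poly_mapping_eqI) (simp add: lookup_act lookup_add)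

lemma act_0 [simp]: "act \<sigma> 0 = 0" by (simp add: act_def)

lemma act_sum: "bij \<sigma> \<Longrightarrow> act \<sigma> (\<Sum>i\<in>S. f i) = (\<Sum>i\<in>S. act \<sigma> (f i))"
  by (induction S rule: infinite_finite_induct) (auto simp: act_add)

lemma act_monom_comp: "bij \<sigma> \<Longrightarrow> bij \<tau> \<Longrightarrow> act_monom \<sigma> (act_monom \<tau> m) = act_monom (\<sigma> \<circ> \<tau>) m"
  by (intro poly_mapping_eqI) (simp add: lookup_act_monom bij_comp o_inv_distrib)

lemma act_comp: "bij \<sigma> \<Longrightarrow> bij \<tau> \<Longrightarrow> act \<sigma> (act \<tau> f) = act (\<sigma> \<circ> \<tau>) f"
  by (intro poly_mapping_eqI)
    (simp add: lookup_act bij_comp o_inv_distrib act_monom_comp bij_imp_bij_inv)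

lemma act_single: "act \<sigma> (single m c) = single (act_monom \<sigma> m) c"
  by (cases "c = 0") (auto simp: act_def)

lemma type_coeff_act: "bij \<sigma> \<Longrightarrow> type_coeff (act \<sigma> f) T = type_coeff f T"
  by (simp add: type_coeff_def act_def pairing_sum mtype_act_monom) (simp add: pairing_def)

section \<open>Scalars, polynomials in n variables, homogeneity and the action on them\<close>

abbreviation scale_mpoly :: "'a::comm_ring_1 \<Rightarrow> 'a mpoly \<Rightarrow> 'a mpoly" where
  "scale_mpoly c f \<equiv> single 0 c * f"

lemma lookup_scale_mpoly: "lookup (scale_mpoly c f) m = c * lookup f m"
proof -
  have "lookup (scale_mpoly c f) m = lookup (Poly_Mapping.map ((*) c) f) m"
    by (simp only: mult_map_scale_conv_mult)
  then show ?thesis by (simp add: Poly_Mapping.map.rep_eq when_def)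
qed

lemma act_scale_mpoly: "bij \<sigma> \<Longrightarrow> act \<sigma> (scale_mpoly c f) = scale_mpoly c (act \<sigma> f)"
  by (intro poly_mapping_eqI) (simp add: lookup_act lookup_scale_mpoly)

lemma type_coeff_scale_mpoly: "type_coeff (scale_mpoly c f) T = c * type_coeff f T"
  using pairing_mult_single[of "\<lambda>m. of_bool (mtype m = T)" f 0 c] by (simp add: type_coeff_def mult.commute)

lemma scale_mpoly_scale_mpoly: "scale_mpoly c (scale_mpoly d f) = scale_mpoly (c * d) f"
  by (simp add: mult.assoc[symmetric] mult_single)

lemma scale_mpoly_add_left: "scale_mpoly (c + d) f = scale_mpoly c f + scale_mpoly d f"
  by (simp add: single_add distrib_right)

definition polys :: "nat \<Rightarrow> 'a::comm_ring_1 mpoly set" where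
  "polys n = {f. \<forall>m\<in>keys f. keys m \<subseteq> {..<n}}"

lemma carrier_KXn: "carrier (KXn n) = polys n" by (simp add: KXn_def polys_def)
lemma restr_eq: "restr I n = I \<inter> polys n" by (simp add: restr_def carrier_KXn)

lemma polys_add: "f \<in> polys n \<Longrightarrow> g \<in> polys n \<Longrightarrow> f + g \<in> polys n"
  using keys_add[of f g] unfolding polys_def by blast
lemma polys_diff: "f \<in> polys n \<Longrightarrow> g \<in> polys n \<Longrightarrow> f - g \<in> polys n"
  using keys_diff[of f g] unfolding polys_def by blast
lemma polys_0: "0 \<in> polys n" by (simp add: polys_def)
lemma polys_sum: "(\<And>i. i \<in> S \<Longrightarrow> f i \<in> polys n) \<Longrightarrow> (\<Sum>i\<in>S. f i) \<in> polys n"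
  by (induction S rule: infinite_finite_induct) (auto simp: polys_0 polys_add)
lemma polys_mult: "f \<in> polys n \<Longrightarrow> g \<in> polys n \<Longrightarrow> f * g \<in> polys n"
proof -
  assume f: "f \<in> polys n" and g: "g \<in> polys n"
  have "keys m \<subseteq> {..<n}" if m: "m \<in> keys (f * g)" for m
  proof -
    obtain a b where "a \<in> keys f" "b \<in> keys g" "m = a + b" using keys_mult[of f g] m by blast
    moreover from this f g have "keys a \<subseteq> {..<n}" "keys b \<subseteq> {..<n}" by (auto simp: polys_def)
    ultimately show ?thesis using keys_add[of a b] by blast
  qed
  then show ?thesis by (simp add: polys_def)
qed
lemma polys_scale_mpoly: "f \<in> polys n \<Longrightarrow> scale_mpoly c f \<in> polys n"
  by (rule polys_mult) (simp_all add: polys_def)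

lemma SymD: "\<sigma> \<in> Sym n \<Longrightarrow> \<sigma> permutes {..<n}" "\<sigma> \<in> Sym n \<Longrightarrow> bij \<sigma>"
  by (auto simp: Sym_def permutes_bij)

lemma Sym_inv: "\<sigma> \<in> Sym n \<Longrightarrow> pinv \<sigma> \<in> Sym n"
  by (simp add: Sym_def permutes_inv)

lemma keys_act_monom:
  assumes "\<sigma> \<in> Sym n" "keys m \<subseteq> {..<n}"
  shows "keys (act_monom \<sigma> m) \<subseteq> {..<n}"
proof
  fix k assume "k \<in> keys (act_monom \<sigma> m)"
  then have "pinv \<sigma> k \<in> keys m" using SymD(2)[OF assms(1)] by (simp add: in_keys_iff lookup_act_monom)
  then have "pinv \<sigma> k \<in> {..<n}" using assms(2) by blast
  then show "k \<in> {..<n}" using permutes_in_image[OF SymD(1)[OF Sym_inv[OF assms(1)]]] by blast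
qed

lemma polys_act:
  assumes "\<sigma> \<in> Sym n" "f \<in> polys n"
  shows "act \<sigma> f \<in> polys n"
  unfolding polys_def
proof (intro CollectI ballI)
  fix k assume "k \<in> keys (act \<sigma> f)"
  then have "act_monom (pinv \<sigma>) k \<in> keys f" using SymD(2)[OF assms(1)] by (simp add: in_keys_iff lookup_act)
  then have "keys (act_monom (pinv \<sigma>) k) \<subseteq> {..<n}" using assms(2) by (simp add: polys_def)
  from keys_act_monom[OF assms(1) this] show "keys k \<subseteq> {..<n}"
    by (simp add: act_monom_inverse SymD(2)[OF assms(1)])
qed

lemma homogeneous_add: "homogeneous d f \<Longrightarrow> homogeneous d g \<Longrightarrow> homogeneous d (f + g)"
  using keys_add[of f g] unfolding homogeneous_def by blast

lemma homogeneous_0: "homogeneous d 0" by (simp add: homogeneous_def)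

lemma homogeneous_sum: "(\<And>i. i \<in> S \<Longrightarrow> homogeneous d (f i)) \<Longrightarrow> homogeneous d (\<Sum>i\<in>S. f i)"
  by (induction S rule: infinite_finite_induct) (auto simp: homogeneous_0 homogeneous_add)

lemma homogeneous_scale_mpoly: "homogeneous d f \<Longrightarrow> homogeneous d (scale_mpoly c f)"
  unfolding homogeneous_def by (auto simp: in_keys_iff lookup_scale_mpoly)

lemma homogeneous_act:
  assumes "bij \<sigma>" "homogeneous d f"
  shows "homogeneous d (act \<sigma> f)"
  unfolding homogeneous_def
proof
  fix m assume "m \<in> keys (act \<sigma> f)"
  then have "act_monom (pinv \<sigma>) m \<in> keys f" using assms(1) by (simp add: in_keys_iff lookup_act)
  then have "monom_degree (act_monom (pinv \<sigma>) m) = d" using assms(2) by (simp add: homogeneous_def)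
  then show "monom_degree m = d"
    using assms(1) by (simp add: sum_mset_mtype[symmetric] mtype_act_monom bij_imp_bij_inv)
qed

definition reynolds :: "nat \<Rightarrow> 'a::field_char_0 mpoly \<Rightarrow> 'a mpoly" where
  "reynolds n f = scale_mpoly (inverse (fact n)) (\<Sum>\<sigma>\<in>Sym n. act \<sigma> f)"

text \<open>For \<open>n\<close> at least \<open>size T\<close> and \<open>T\<close> without zeros
  this is a multiple of the monomial symmetric polynomial, normalised to have coordinate 1 at
  \<open>T\<close>.\<close>

definition sym_monom :: "nat \<Rightarrow> nat multiset \<Rightarrow> 'a::field_char_0 mpoly" where
  "sym_monom n T = reynolds n (single (sorted_monom T) 1)"

lemma card_Sym: "card (Sym n) = fact n" by (simp add: Sym_def card_permutations)

lemma reynolds_add: "reynolds n (f + g) = reynolds n f + reynolds n g"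
proof -
  have "(\<Sum>\<sigma>\<in>Sym n. act \<sigma> (f + g)) = (\<Sum>\<sigma>\<in>Sym n. act \<sigma> f) + (\<Sum>\<sigma>\<in>Sym n. act \<sigma> g)"
    unfolding sum.distrib[symmetric] by (intro sum.cong) (simp_all add: act_add SymD)
  then show ?thesis by (simp add: reynolds_def distrib_left)
qed

lemma reynolds_0 [simp]: "reynolds n 0 = 0" by (simp add: reynolds_def)

lemma reynolds_sum: "reynolds n (\<Sum>i\<in>S. f i) = (\<Sum>i\<in>S. reynolds n (f i))"
  by (induction S rule: infinite_finite_induct) (auto simp: reynolds_add)

lemma reynolds_scale_mpoly: "reynolds n (scale_mpoly c f) = scale_mpoly c (reynolds n f)"
proof -
  have "(\<Sum>\<sigma>\<in>Sym n. act \<sigma> (scale_mpoly c f)) = scale_mpoly c (\<Sum>\<sigma>\<in>Sym n. act \<sigma> f)"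
    unfolding sum_distrib_left by (intro sum.cong) (simp_all add: act_scale_mpoly SymD)
  then show ?thesis by (simp add: reynolds_def mult.left_commute)
qed

lemma reynolds_act:
  assumes "\<tau> \<in> Sym n"
  shows "reynolds n (act \<tau> f) = reynolds n f"
proof -
  have "(\<Sum>\<sigma>\<in>Sym n. act \<sigma> (act \<tau> f)) = (\<Sum>\<sigma>\<in>Sym n. act (\<sigma> \<circ> \<tau>) f)"
    by (rule sum.cong[OF refl]) (rule act_comp[OF SymD(2) SymD(2)[OF assms]])
  also have "\<dots> = (\<Sum>\<sigma>\<in>Sym n. act \<sigma> f)"
    unfolding Sym_def by (rule sum_permutations_compose_right[OF SymD(1)[OF assms], symmetric])
  finally show ?thesis by (simp add: reynolds_def)
qed

lemma act_reynolds:
  assumes "\<tau> \<in> Sym n"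
  shows "act \<tau> (reynolds n f) = reynolds n f"
proof -
  have "act \<tau> (\<Sum>\<sigma>\<in>Sym n. act \<sigma> f) = (\<Sum>\<sigma>\<in>Sym n. act (\<tau> \<circ> \<sigma>) f)"
    unfolding act_sum[OF SymD(2)[OF assms]]
    by (rule sum.cong[OF refl]) (rule act_comp[OF SymD(2)[OF assms] SymD(2)])
  also have "\<dots> = (\<Sum>\<sigma>\<in>Sym n. act \<sigma> f)"
    unfolding Sym_def by (rule setum_permutations_compose_left[OF SymD(1)[OF assms], symmetric])
  finally show ?thesis by (simp add: reynolds_def act_scale_mpoly SymD(2)[OF assms])
qed

text \<open>All monomials of an orbit have the same type, so averaging is invisible in the
  coinvariants. This links invariants for a given n with data independent of n.\<close>

lemma type_coeff_reynolds: "type_coeff (reynolds n f) T = type_coeff f T"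
proof -
  have "type_coeff (reynolds n f) T = inverse (fact n) * (\<Sum>\<sigma>\<in>Sym n. type_coeff f T)"
    unfolding reynolds_def type_coeff_scale_mpoly type_coeff_sum
    by (intro arg_cong[of _ _ "(*) _"] sum.cong) (simp_all add: type_coeff_act SymD)
  then show ?thesis by (simp add: card_Sym)
qed

lemma type_coeff_sym_monom: "0 \<notin># T \<Longrightarrow> type_coeff (sym_monom n T) U = of_bool (T = U)"
  unfolding sym_monom_def type_coeff_reynolds by (simp add: type_coeff_def mtype_sorted_monom)

lemma reynolds_polys: "f \<in> polys n \<Longrightarrow> reynolds n f \<in> polys n"
  unfolding reynolds_def by (intro polys_scale_mpoly polys_sum polys_act)

lemma reynolds_homogeneous: "homogeneous d f \<Longrightarrow> homogeneous d (reynolds n f)"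
  unfolding reynolds_def by (intro homogeneous_scale_mpoly homogeneous_sum homogeneous_act SymD)

lemma reynolds_single:
  assumes "keys m \<subseteq> {..<n}"
  shows "reynolds n (single m 1) = sym_monom n (mtype m)"
proof -
  have "card (keys m) \<le> card {..<n}" using assms by (intro card_mono) auto
  then have "keys (sorted_monom (mtype m)) \<subseteq> {..<n}" by (auto simp: keys_sorted_monom zero_notin_mtype size_mtype)
  from mtype_eq_permutes[OF finite_lessThan assms this] obtain p where
    p: "p permutes {..<n}" "\<And>i. lookup m i = lookup (sorted_monom (mtype m)) (p i)"
    by (auto simp: mtype_sorted_monom zero_notin_mtype)
  have "act_monom p m = sorted_monom (mtype m)"
    using p permutes_bij[OF p(1)]
    by (intro poly_mapping_eqI) (simp add: lookup_act_monom bij_is_surj surj_f_inv_f)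
  then have "reynolds n (single (sorted_monom (mtype m)) 1) = reynolds n (act p (single m 1))" by (simp add: act_single)
  also have "\<dots> = reynolds n (single m 1)" using p(1) by (intro reynolds_act) (simp add: Sym_def)
  finally show ?thesis unfolding sym_monom_def by (rule sym)
qed

text \<open>Within K[X_n] a monomial and its sorted representative lie in one Sym(n)-orbit, so the
  average of \<open>f\<close> depends only on its type coordinates.\<close>

lemma reynolds_expand:
  assumes "f \<in> polys n"
  shows "reynolds n f = (\<Sum>T\<in>mtype ` keys f. scale_mpoly (type_coeff f T) (sym_monom n T))"
proof -
  have "reynolds n f = (\<Sum>m\<in>keys f. reynolds n (single m (lookup f m)))"
    by (subst mpoly_expand) (rule reynolds_sum)
  also have "\<dots> = (\<Sum>m\<in>keys f. scale_mpoly (lookup f m) (sym_monom n (mtype m)))"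
  proof (rule sum.cong)
    fix m assume "m \<in> keys f"
    then have "keys m \<subseteq> {..<n}" using assms by (simp add: polys_def)
    moreover have "single m (lookup f m) = scale_mpoly (lookup f m) (single m 1)" by (simp add: mult_single)
    ultimately show "reynolds n (single m (lookup f m)) = scale_mpoly (lookup f m) (sym_monom n (mtype m))"
      by (simp only: reynolds_scale_mpoly reynolds_single)
  qed simp
  also have "\<dots> = (\<Sum>T\<in>mtype ` keys f. scale_mpoly (type_coeff f T) (sym_monom n T))"
  proof (rule poly_mapping_eqI)
    fix k
    have "(\<Sum>m\<in>keys f. lookup f m * lookup (sym_monom n (mtype m)) k) = pairing (\<lambda>m. lookup (sym_monom n (mtype m)) k) f"
      by (simp add: pairing_def)
    also have "\<dots> = (\<Sum>T\<in>mtype ` keys f. lookup (sym_monom n T) k * type_coeff f T)" by (rule pairing_mtype)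
    finally show "lookup (\<Sum>m\<in>keys f. scale_mpoly (lookup f m) (sym_monom n (mtype m))) k =
        lookup (\<Sum>T\<in>mtype ` keys f. scale_mpoly (type_coeff f T) (sym_monom n T)) k"
      by (simp only: lookup_sum lookup_scale_mpoly mult.commute[of "type_coeff f _"])
  qed
  finally show ?thesis .
qed

section \<open>The invariants of the quotient\<close>

text \<open>Separates the linear algebra of cosets from the main argument: independence and spanning
  become membership of polynomial combinations in \<open>I\<close>.\<close>

lemma dim_eq_card:
  fixes V :: "('a::field, 'c) module" and residue_class :: "'a mpoly \<Rightarrow> 'c"
  assumes car: "carrier V = residue_class ` W" and zero: "\<zero>\<^bsub>V\<^esub> = residue_class 0"
    and W: "0 \<in> W" "\<And>f g. f \<in> W \<Longrightarrow> g \<in> W \<Longrightarrow> f + g \<in> W" "\<And>c f. f \<in> W \<Longrightarrow> scale_mpoly c f \<in> W"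
    and add: "\<And>f g. f \<in> W \<Longrightarrow> g \<in> W \<Longrightarrow> residue_class f \<oplus>\<^bsub>V\<^esub> residue_class g = residue_class (f + g)"
    and smult: "\<And>c f. f \<in> W \<Longrightarrow> c \<odot>\<^bsub>V\<^esub> residue_class f = residue_class (scale_mpoly c f)"
    and eq: "\<And>f g. f \<in> W \<Longrightarrow> g \<in> W \<Longrightarrow> residue_class f = residue_class g \<longleftrightarrow> f - g \<in> I"
    and N: "finite N" "\<And>i. i \<in> N \<Longrightarrow> b i \<in> W"
    and indep: "\<And>a. (\<Sum>i\<in>N. scale_mpoly (a i) (b i)) \<in> I \<Longrightarrow> \<forall>i\<in>N. a i = 0"
    and span: "\<And>f. f \<in> W \<Longrightarrow> \<exists>a. f - (\<Sum>i\<in>N. scale_mpoly (a i) (b i)) \<in> I"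
  shows "vectorspace.dim class_ring V = card N"
proof -
  have W_uminus: "- f \<in> W" if "f \<in> W" for f
  proof -
    have "scale_mpoly (- 1) f = - f" by (intro poly_mapping_eqI) (simp add: lookup_scale_mpoly)
    with W(3)[OF that, of "- 1"] show ?thesis by simp
  qed
  have "vectorspace class_ring V"
  proof (rule vs_criteria)
    show "field (class_ring :: 'a ring)" by (rule class_field.field_axioms)
    show "\<forall>v\<in>carrier V. \<exists>w\<in>carrier V. v \<oplus>\<^bsub>V\<^esub> w = \<zero>\<^bsub>V\<^esub>"
    proof
      fix v assume "v \<in> carrier V"
      then obtain f where "f \<in> W" "v = residue_class f" by (auto simp: car)
      then show "\<exists>w\<in>carrier V. v \<oplus>\<^bsub>V\<^esub> w = \<zero>\<^bsub>V\<^esub>"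
        using W_uminus add[of f "- f"] by (intro bexI[of _ "residue_class (- f)"]) (auto simp: car zero)
    qed
  qed (auto simp: car zero W add smult add_ac scale_mpoly_scale_mpoly scale_mpoly_add_left distrib_left)
  then interpret V: vectorspace "class_ring :: 'a ring" V .
  define c where "c i = residue_class (b i)" for i
  have inj: "inj_on c N"
  proof (rule inj_onI, rule ccontr)
    fix i j assume ij: "i \<in> N" "j \<in> N" "c i = c j" "i \<noteq> j"
    \<comment> \<open>Equal classes would give the relation \<open>b i - b j\<close> in
      \<open>I\<close>. So independence of the family also makes the classes distinct, as needed to
      count a basis that is a set.\<close>
    define a where "a k = (if k = i then 1 else if k = j then - 1 else (0::'a))" for k
    have "(\<Sum>k\<in>N. scale_mpoly (a k) (b k)) = (\<Sum>k\<in>{i, j}. scale_mpoly (a k) (b k))"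
      using N(1) ij by (intro sum.mono_neutral_right) (auto simp: a_def)
    also have "\<dots> = b i - b j"
    proof -
      have "scale_mpoly (- 1) (b j) = - b j" by (intro poly_mapping_eqI) (simp add: lookup_scale_mpoly)
      then show ?thesis using ij(4) by (simp add: a_def)
    qed
    also have "\<dots> \<in> I" using eq[OF N(2)[OF ij(1)] N(2)[OF ij(2)]] ij(3) by (simp add: c_def)
    finally have "a i = 0" using indep[of a] ij(1) by blast
    then show False by (simp add: a_def)
  qed
  have c_car: "c ` N \<subseteq> carrier V" using N(2) by (auto simp: c_def car)
  have W_sum: "(\<Sum>i\<in>S. f i) \<in> W" if "\<And>i. i \<in> S \<Longrightarrow> f i \<in> W" for S :: "'b set" and f
    using that by (induction S rule: infinite_finite_induct) (auto simp: W)
  have finsum: "finsum V (\<lambda>i. residue_class (f i)) S = residue_class (\<Sum>i\<in>S. f i)"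
    if "finite S" "\<And>i. i \<in> S \<Longrightarrow> f i \<in> W" for S :: "'b set" and f
    using that
  proof (induction S rule: finite_induct)
    case empty
    then show ?case by (simp add: zero)
  next
    case (insert i S)
    then show ?case using W_sum[of S f] by (subst V.finsum_insert) (auto simp: car add)
  qed
  have lincomb: "V.lincomb a (c ` N) = residue_class (\<Sum>i\<in>N. scale_mpoly (a (c i)) (b i))" for a
  proof -
    have "V.lincomb a (c ` N) = finsum V (\<lambda>v. a v \<odot>\<^bsub>V\<^esub> v) (c ` N)" by (simp add: V.lincomb_def)
    also have "\<dots> = finsum V (\<lambda>i. a (c i) \<odot>\<^bsub>V\<^esub> c i) N"
      using N(2) W(3) by (intro V.add.finprod_reindex inj) (auto simp: c_def smult car)
    also have "\<dots> = finsum V (\<lambda>i. residue_class (scale_mpoly (a (c i)) (b i))) N"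
      using N(2) W(3) by (intro V.finsum_cong') (auto simp: c_def smult car)
    also have "\<dots> = residue_class (\<Sum>i\<in>N. scale_mpoly (a (c i)) (b i))"
      using N W(3) by (intro finsum) auto
    finally show ?thesis .
  qed
  have comb_W: "(\<Sum>i\<in>N. scale_mpoly (a i) (b i)) \<in> W" for a
    using N(2) W(3) by (intro W_sum) auto
  have "V.basis (c ` N)"
    unfolding V.basis_def
  proof (intro conjI)
    show "c ` N \<subseteq> carrier V" by (rule c_car)
    show "\<not> V.lin_dep (c ` N)"
    proof (rule V.finite_lin_indpt2)
      fix a assume "V.lincomb a (c ` N) = \<zero>\<^bsub>V\<^esub>"
      then have "(\<Sum>i\<in>N. scale_mpoly (a (c i)) (b i)) \<in> I"
        using eq[OF comb_W W(1), of "\<lambda>i. a (c i)"] by (simp add: lincomb zero)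
      from indep[OF this] show "\<forall>v\<in>c ` N. a v = \<zero>\<^bsub>class_ring\<^esub>" by auto
    qed (use N c_car in auto)
    have "carrier V \<subseteq> V.span (c ` N)"
    proof
      fix v assume "v \<in> carrier V"
      then obtain f where f: "f \<in> W" "v = residue_class f" by (auto simp: car)
      from span[OF f(1)] obtain a where a: "f - (\<Sum>i\<in>N. scale_mpoly (a i) (b i)) \<in> I" by blast
      define a' where "a' = a \<circ> the_inv_into N c"
      have "v = residue_class (\<Sum>i\<in>N. scale_mpoly (a i) (b i))" using a eq[OF f(1) comb_W] f(2) by simp
      also have "(\<Sum>i\<in>N. scale_mpoly (a i) (b i)) = (\<Sum>i\<in>N. scale_mpoly (a' (c i)) (b i))"
        by (intro sum.cong) (simp_all add: a'_def the_inv_into_f_f inj)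
      finally have "v = V.lincomb a' (c ` N)" by (simp only: lincomb)
      then show "v \<in> V.span (c ` N)"
        unfolding V.span_def using N(1) by (intro CollectI exI[of _ a'] exI[of _ "c ` N"]) auto
    qed
    moreover have "V.span (c ` N) \<subseteq> carrier V"
      using c_car V.span_is_subset2 by blast
    ultimately show "V.span (c ` N) = carrier V" by blast
  qed
  from V.dim_basis[OF _ this] N(1) show ?thesis by (simp add: card_image inj)
qed

lemma type_le_max_exists:
  assumes "finite S" "S \<noteq> {}"
  shows "\<exists>m\<in>S. \<forall>x\<in>S. type_le c x m"
  using assms
proof (induction rule: finite_ne_induct)
  case (singleton x)
  then show ?case by (simp add: type_le_refl)
next
  case (insert x S)
  then obtain m where m: "m \<in> S" "\<forall>y\<in>S. type_le c y m" by blast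
  show ?case
  proof (cases "type_le c x m")
    case True
    with m show ?thesis by auto
  next
    case False
    then have "type_le c m x" using type_le_total by blast
    then have "type_le c y x" if "y \<in> S" for y using m(2) that type_le_trans by blast
    then show ?thesis by (auto simp: type_le_refl)
  qed
qed

lemma mtype_keys_homogeneous: "homogeneous d f \<Longrightarrow> mtype ` keys f \<subseteq> parts d"
  by (auto simp: parts_def homogeneous_def sum_mset_mtype zero_notin_mtype)

locale sym_ideal = KX_ideal_char_0 I for I :: "'a::field_char_0 mpoly set" +
  assumes hom: "homogeneous_ideal I" and symm: "symmetric_ideal I"
begin

lemma I_act: "\<sigma> \<in> Sym n \<Longrightarrow> n \<ge> 1 \<Longrightarrow> f \<in> I \<Longrightarrow> act \<sigma> f \<in> I"
  using symm unfolding symmetric_ideal_def Sym_infinity_def by auto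

lemma I_scale_mpoly: "f \<in> I \<Longrightarrow> scale_mpoly c f \<in> I"
  using I_mult[of f "single 0 c"] by (simp add: mult.commute)

lemma I_reynolds: "n \<ge> 1 \<Longrightarrow> f \<in> I \<Longrightarrow> reynolds n f \<in> I"
  unfolding reynolds_def by (intro I_scale_mpoly I_sum I_act)

lemma leads_homogeneous:
  assumes "T \<in> leads c" "sum_mset T = d"
  shows "\<exists>f\<in>I. homogeneous d f \<and> type_coeff f T \<noteq> 0 \<and> (\<forall>S. type_coeff f S \<noteq> 0 \<longrightarrow> type_le c S T)"
proof -
  obtain f where f: "f \<in> I" "type_coeff f T \<noteq> 0" "\<And>S. type_coeff f S \<noteq> 0 \<Longrightarrow> type_le c S T"
    using assms by (auto simp: leads_def)
  have "homogeneous_component d f \<in> I" using hom f(1) by (simp add: homogeneous_ideal_def)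
  moreover have "homogeneous d (homogeneous_component d f)"
    by (simp add: homogeneous_def keys_homogeneous_component)
  ultimately show ?thesis using f assms(2)
    by (intro bexI[of _ "homogeneous_component d f"]) (auto simp: type_coeff_homogeneous_component)
qed

lemma leads_witnesses:
  "\<exists>n0. \<forall>n\<ge>n0. \<forall>T\<in>parts d \<inter> leads c.
    \<exists>f\<in>I \<inter> polys n. homogeneous d f \<and> type_coeff f T \<noteq> 0 \<and> (\<forall>S. type_coeff f S \<noteq> 0 \<longrightarrow> type_le c S T)"
proof -
  have "\<forall>T\<in>parts d \<inter> leads c.
      \<exists>f. f \<in> I \<and> homogeneous d f \<and> type_coeff f T \<noteq> 0 \<and> (\<forall>S. type_coeff f S \<noteq> 0 \<longrightarrow> type_le c S T)"
    using leads_homogeneous unfolding parts_def by blast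
  then obtain F where F: "\<And>T. T \<in> parts d \<inter> leads c \<Longrightarrow> F T \<in> I \<and> homogeneous d (F T) \<and>
      type_coeff (F T) T \<noteq> 0 \<and> (\<forall>S. type_coeff (F T) S \<noteq> 0 \<longrightarrow> type_le c S T)" by metis
  obtain n0 where n0: "\<forall>m\<in>(\<Union>T\<in>parts d \<inter> leads c. keys (F T)). keys m \<subseteq> {..<n0}"
    using keys_bound[of "\<Union>T\<in>parts d \<inter> leads c. keys (F T)" 0] finite_parts[of d] by auto
  have "F T \<in> polys n" if "n0 \<le> n" "T \<in> parts d \<inter> leads c" for n T
    using n0 that unfolding polys_def by fastforce
  with F show ?thesis by (intro exI[of _ n0]) blast
qed

section \<open>Cosets of I_n, the operations on them and the invariant classes\<close>

definition residue_class :: "nat \<Rightarrow> 'a mpoly \<Rightarrow> 'a mpoly set" where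
  "residue_class n f = (\<lambda>h. h + f) ` (I \<inter> polys n)"

lemma residue_class_eq:
  assumes "f \<in> polys n" "g \<in> polys n"
  shows "residue_class n f = residue_class n g \<longleftrightarrow> f - g \<in> I"
proof
  assume "residue_class n f = residue_class n g"
  moreover have "f \<in> residue_class n f" by (auto simp: residue_class_def I_zero polys_0 image_iff intro!: bexI[of _ 0])
  ultimately show "f - g \<in> I" by (auto simp: residue_class_def)
next
  have sub: "residue_class n f \<subseteq> residue_class n g" if "f \<in> polys n" "g \<in> polys n" "f - g \<in> I" for f g
  proof
    fix h assume "h \<in> residue_class n f"
    then obtain j where j: "j \<in> I \<inter> polys n" "h = j + f" by (auto simp: residue_class_def)
    have "h = (j + (f - g)) + g" using j(2) by simp
    moreover have "j + (f - g) \<in> I \<inter> polys n" using j(1) that by (auto intro: I_add polys_add polys_diff)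
    ultimately show "h \<in> residue_class n g" unfolding residue_class_def by blast
  qed
  assume "f - g \<in> I"
  moreover from I_uminus[OF this] have "g - f \<in> I" by simp
  ultimately show "residue_class n f = residue_class n g" using sub assms by blast
qed

lemma coset_eq: "restr I n +>\<^bsub>KXn n\<^esub> f = residue_class n f"
  by (auto simp: a_r_coset_def' residue_class_def restr_eq KXn_def)

lemma residue_class_self: "f \<in> residue_class n f"
  by (auto simp: residue_class_def I_zero polys_0 image_iff intro!: bexI[of _ 0])

lemma carrier_quot: "carrier (quot I n) = residue_class n ` polys n"
  by (auto simp: quot_def Let_def FactRing_def A_RCOSETS_def' coset_eq carrier_KXn)

lemma zero_quot: "\<zero>\<^bsub>quot I n\<^esub> = residue_class n 0"
  by (auto simp: quot_def Let_def FactRing_def residue_class_def restr_eq)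

lemma add_quot: "residue_class n f \<oplus>\<^bsub>quot I n\<^esub> residue_class n g = residue_class n (f + g)"
proof -
  have "residue_class n f \<oplus>\<^bsub>quot I n\<^esub> residue_class n g = (\<Union>h\<in>residue_class n f. \<Union>k\<in>residue_class n g. {h + k})"
    by (simp add: quot_def Let_def FactRing_def set_add_def' KXn_def)
  also have "\<dots> = residue_class n (f + g)"
  proof (intro equalityI subsetI)
    fix x assume "x \<in> (\<Union>h\<in>residue_class n f. \<Union>k\<in>residue_class n g. {h + k})"
    then obtain i j where "i \<in> I \<inter> polys n" "j \<in> I \<inter> polys n" "x = (i + j) + (f + g)"
      by (auto simp: residue_class_def add_ac)
    moreover from this have "i + j \<in> I \<inter> polys n" by (auto intro: I_add polys_add)
    ultimately show "x \<in> residue_class n (f + g)" unfolding residue_class_def by blast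
  next
    fix x assume "x \<in> residue_class n (f + g)"
    then obtain j where "j \<in> I \<inter> polys n" "x = (j + f) + g" by (auto simp: residue_class_def add_ac)
    then have "j + f \<in> residue_class n f" "x = (j + f) + g" by (auto simp: residue_class_def)
    then show "x \<in> (\<Union>h\<in>residue_class n f. \<Union>k\<in>residue_class n g. {h + k})" using residue_class_self by blast
  qed
  finally show ?thesis .
qed

text \<open>The product of cosets is a union over all pairs of representatives; every pair
  contributes the same coset, because \<open>I\<close> is an ideal.\<close>

lemma smult_quot:
  assumes "f \<in> polys n"
  shows "c \<odot>\<^bsub>quot I n\<^esub> residue_class n f = residue_class n (scale_mpoly c f)"
proof -
  have c: "single 0 c \<in> polys n" by (simp add: polys_def)
  have "c \<odot>\<^bsub>quot I n\<^esub> residue_class n f = (\<Union>a\<in>residue_class n (single 0 c). \<Union>b\<in>residue_class n f. residue_class n (a * b))"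
    by (simp add: quot_def Let_def FactRing_def rcoset_mult_def coset_eq) (simp add: KXn_def)
  also have "\<dots> = residue_class n (scale_mpoly c f)"
  proof -
    have "residue_class n (a * b) = residue_class n (scale_mpoly c f)" if ab: "a \<in> residue_class n (single 0 c)" "b \<in> residue_class n f" for a b
    proof -
      obtain i j where ij: "i \<in> I \<inter> polys n" "j \<in> I \<inter> polys n" "a = i + single 0 c" "b = j + f"
        using ab unfolding residue_class_def by blast
      have "a * b - scale_mpoly c f = i * b + j * single 0 c" by (simp add: ij algebra_simps)
      also have "\<dots> \<in> I" using ij by (intro I_add I_mult) auto
      finally show ?thesis using ij assms c by (subst residue_class_eq) (auto intro!: polys_mult polys_add)
    qed
    then show ?thesis using residue_class_self by blast
  qed
  finally show ?thesis .
qed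

text \<open>These representatives are invariant only modulo \<open>I\<close>; the Reynolds operator
  later replaces them by congruent invariant polynomials.\<close>

definition inv_piece :: "nat \<Rightarrow> nat \<Rightarrow> 'a mpoly set" where
  "inv_piece n d = {f \<in> polys n. homogeneous d f \<and> (\<forall>\<sigma>\<in>Sym n. act \<sigma> f - f \<in> I)}"

lemma act_residue_class:
  assumes "\<sigma> \<in> Sym n" "n \<ge> 1"
  shows "act \<sigma> ` residue_class n f = residue_class n (act \<sigma> f)"
proof -
  have b: "bij \<sigma>" "bij (pinv \<sigma>)" using SymD(2)[OF assms(1)] by (auto simp: bij_imp_bij_inv)
  have stable: "act \<tau> h \<in> I \<inter> polys n" if "\<tau> \<in> Sym n" "h \<in> I \<inter> polys n" for \<tau> h
    using that assms(2) I_act polys_act by blast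
  have "act \<sigma> ` (I \<inter> polys n) = I \<inter> polys n"
  proof (intro equalityI subsetI)
    fix h assume h: "h \<in> I \<inter> polys n"
    have "act \<sigma> (act (pinv \<sigma>) h) = h"
      by (rule poly_mapping_eqI)
        (simp add: lookup_act b act_monom_inverse inv_inv_eq)
    then show "h \<in> act \<sigma> ` (I \<inter> polys n)"
      using stable[OF Sym_inv[OF assms(1)] h] by (metis image_eqI)
  qed (use stable[OF assms(1)] in auto)
  moreover have "act \<sigma> ` residue_class n f = (\<lambda>h. h + act \<sigma> f) ` act \<sigma> ` (I \<inter> polys n)"
    unfolding residue_class_def image_image by (simp add: act_add b)
  ultimately show ?thesis by (simp add: residue_class_def)
qed

text \<open>A homogeneous element of the coset can itself serve as its representative, and
  invariance of the coset then becomes a family of congruences modulo \<open>I\<close>.\<close>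

lemma carrier_piece:
  assumes "n \<ge> 1"
  shows "carrier (quot_Sym_piece I n d) = residue_class n ` inv_piece n d"
proof (intro equalityI subsetI)
  fix C assume "C \<in> carrier (quot_Sym_piece I n d)"
  then obtain g f where C: "C = residue_class n g" "g \<in> polys n" "f \<in> C" "homogeneous d f"
      "\<And>\<sigma>. \<sigma> \<in> Sym n \<Longrightarrow> act \<sigma> ` C = C"
    by (auto simp: quot_Sym_piece_def carrier_quot)
  obtain h where h: "h \<in> I \<inter> polys n" "f = h + g" using C(1,3) by (auto simp: residue_class_def)
  have f: "f \<in> polys n" using h C(2) by (auto intro: polys_add)
  have Cf: "C = residue_class n f" using residue_class_eq[OF f C(2)] h C(1) by simp
  have "act \<sigma> f - f \<in> I" if "\<sigma> \<in> Sym n" for \<sigma>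
  proof -
    have "residue_class n (act \<sigma> f) = residue_class n f" using C(5)[OF that] act_residue_class[OF that assms] by (simp add: Cf)
    then show ?thesis using residue_class_eq[OF polys_act[OF that f] f] by simp
  qed
  then show "C \<in> residue_class n ` inv_piece n d" using f C(4) Cf by (auto simp: inv_piece_def)
next
  fix C assume "C \<in> residue_class n ` inv_piece n d"
  then obtain f where f: "f \<in> polys n" "homogeneous d f" "\<And>\<sigma>. \<sigma> \<in> Sym n \<Longrightarrow> act \<sigma> f - f \<in> I" "C = residue_class n f"
    by (auto simp: inv_piece_def)
  have "act \<sigma> ` C = C" if "\<sigma> \<in> Sym n" for \<sigma>
    using act_residue_class[OF that assms] residue_class_eq[OF polys_act[OF that f(1)] f(1)] f(3)[OF that] f(4) by simp
  then show "C \<in> carrier (quot_Sym_piece I n d)"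
    using f residue_class_self by (auto simp: quot_Sym_piece_def carrier_quot)
qed

text \<open>The averages of nonleading types are independent by the definition of leading types and
  span by a division algorithm. As a type of degree \<open>d\<close> has at most \<open>d\<close>
  entries, \<open>n \<ge> d\<close> lets all of them fit into \<open>n\<close> variables.\<close>

lemma dim_piece:
  assumes n: "n \<ge> 1" "n \<ge> d"
    and wit: "\<And>T. T \<in> parts d \<inter> leads c \<Longrightarrow>
      \<exists>f\<in>I \<inter> polys n. homogeneous d f \<and> type_coeff f T \<noteq> 0 \<and> (\<forall>S. type_coeff f S \<noteq> 0 \<longrightarrow> type_le c S T)"
  shows "vectorspace.dim class_ring (quot_Sym_piece I n d) = card (parts d - leads c)"
proof (rule dim_eq_card[where residue_class = "residue_class n" and W = "inv_piece n d" and I = I and b = "sym_monom n"])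
  let ?V = "quot_Sym_piece I n d" and ?N = "parts d - leads c"
  have WKn: "inv_piece n d \<subseteq> polys n" by (auto simp: inv_piece_def)
  show "carrier ?V = residue_class n ` inv_piece n d" by (rule carrier_piece[OF n(1)])
  show "\<zero>\<^bsub>?V\<^esub> = residue_class n 0" using zero_quot[of n] by (simp add: quot_Sym_piece_def)
  show "0 \<in> inv_piece n d" by (simp add: inv_piece_def polys_0 homogeneous_0 I_zero)
  show "f + g \<in> inv_piece n d" if "f \<in> inv_piece n d" "g \<in> inv_piece n d" for f g
  proof -
    have "act \<sigma> (f + g) - (f + g) \<in> I" if s: "\<sigma> \<in> Sym n" for \<sigma>
    proof -
      have "act \<sigma> (f + g) - (f + g) = (act \<sigma> f - f) + (act \<sigma> g - g)"
        using SymD(2)[OF s] by (simp add: act_add)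
      also have "\<dots> \<in> I" using \<open>f \<in> inv_piece n d\<close> \<open>g \<in> inv_piece n d\<close> s by (intro I_add) (auto simp: inv_piece_def)
      finally show ?thesis .
    qed
    with that show ?thesis by (simp add: inv_piece_def polys_add homogeneous_add)
  qed
  show "scale_mpoly a f \<in> inv_piece n d" if "f \<in> inv_piece n d" for a f
  proof -
    have "act \<sigma> (scale_mpoly a f) - scale_mpoly a f \<in> I" if s: "\<sigma> \<in> Sym n" for \<sigma>
    proof -
      have "act \<sigma> (scale_mpoly a f) - scale_mpoly a f = scale_mpoly a (act \<sigma> f - f)"
        using SymD(2)[OF s] by (simp add: act_scale_mpoly right_diff_distrib)
      also have "\<dots> \<in> I" using \<open>f \<in> inv_piece n d\<close> s by (intro I_scale_mpoly) (auto simp: inv_piece_def)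
      finally show ?thesis .
    qed
    with that show ?thesis by (simp add: inv_piece_def polys_scale_mpoly homogeneous_scale_mpoly)
  qed
  show "residue_class n f \<oplus>\<^bsub>?V\<^esub> residue_class n g = residue_class n (f + g)" for f g
    using add_quot[of n f g] by (simp add: quot_Sym_piece_def)
  show "a \<odot>\<^bsub>?V\<^esub> residue_class n f = residue_class n (scale_mpoly a f)" if "f \<in> inv_piece n d" for a f
    using smult_quot[of f n a] that WKn by (auto simp: quot_Sym_piece_def)
  show "residue_class n f = residue_class n g \<longleftrightarrow> f - g \<in> I" if "f \<in> inv_piece n d" "g \<in> inv_piece n d" for f g
    using residue_class_eq that WKn by blast
  show "finite ?N" using finite_parts by simp
  have sorted_monom_d: "single (sorted_monom T) (1::'a) \<in> polys n" "homogeneous d (single (sorted_monom T) (1::'a))" if "T \<in> parts d" for T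
  proof -
    have T: "0 \<notin># T" "sum_mset T = d" using that by (auto simp: parts_def)
    have "size T \<le> sum_mset T" using T(1)
    proof (induction T)
      case (add x T)
      then show ?case by (cases x) auto
    qed simp
    then have "keys (sorted_monom T) \<subseteq> {..<n}" using T n(2) by (auto simp: keys_sorted_monom)
    then show "single (sorted_monom T) (1::'a) \<in> polys n" by (simp add: polys_def)
    show "homogeneous d (single (sorted_monom T) (1::'a))"
      using T mtype_sorted_monom[OF T(1)] by (simp add: homogeneous_def sum_mset_mtype[symmetric])
  qed
  show sym_monom_W: "sym_monom n T \<in> inv_piece n d" if "T \<in> ?N" for T
    using sorted_monom_d[of T] that by (simp add: inv_piece_def sym_monom_def reynolds_polys reynolds_homogeneous act_reynolds I_zero)
  show "\<forall>T\<in>?N. a T = 0" if a: "(\<Sum>T\<in>?N. scale_mpoly (a T) (sym_monom n T)) \<in> I" for a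
  proof (rule ccontr)
    let ?h = "\<Sum>T\<in>?N. scale_mpoly (a T) (sym_monom n T)"
    assume "\<not> ?thesis"
    then have "{T \<in> ?N. a T \<noteq> 0} \<noteq> {}" by blast
    \<comment> \<open>The largest type in a combination that lies in \<open>I\<close> would be a
      leading type.\<close>
    then obtain M where M: "M \<in> ?N" "a M \<noteq> 0" "\<And>T. T \<in> ?N \<Longrightarrow> a T \<noteq> 0 \<Longrightarrow> type_le c T M"
      using type_le_max_exists[of "{T \<in> ?N. a T \<noteq> 0}" c] finite_parts[of d] by auto
    have tch: "type_coeff ?h U = (if U \<in> ?N then a U else 0)" for U
    proof -
      have "type_coeff ?h U = (\<Sum>T\<in>?N. if T = U then a T else 0)"
        unfolding type_coeff_sum type_coeff_scale_mpoly by (intro sum.cong) (auto simp: type_coeff_sym_monom parts_def)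
      then show ?thesis using finite_parts[of d] by simp
    qed
    have "M \<in> leads c"
    proof (rule leadsI[OF a])
      show "type_coeff ?h M \<noteq> 0" using M(1,2) by (simp add: tch)
      show "type_le c S M" if "type_coeff ?h S \<noteq> 0" for S using that M(3)[of S] by (auto simp: tch split: if_splits)
    qed
    with M(1) show False by blast
  qed
  define Sp where "Sp = {h. \<exists>a. h - (\<Sum>T\<in>?N. scale_mpoly (a T) (sym_monom n T)) \<in> I}"
  have SpI: "h - (\<Sum>T\<in>?N. scale_mpoly (a T) (sym_monom n T)) \<in> I \<Longrightarrow> h \<in> Sp" for h a
    unfolding Sp_def by (rule CollectI) (rule exI)
  have Sp_I: "h \<in> Sp" if "h \<in> I" for h
    using that by (intro SpI[of _ "\<lambda>_. 0"]) simp
  have Sp_add: "h + k \<in> Sp" if hk: "h \<in> Sp" "k \<in> Sp" for h k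
  proof -
    obtain a b where "h - (\<Sum>T\<in>?N. scale_mpoly (a T) (sym_monom n T)) \<in> I" "k - (\<Sum>T\<in>?N. scale_mpoly (b T) (sym_monom n T)) \<in> I"
      using hk by (auto simp: Sp_def)
    from I_add[OF this] have "h + k - (\<Sum>T\<in>?N. scale_mpoly (a T + b T) (sym_monom n T)) \<in> I"
      by (simp only: scale_mpoly_add_left sum.distrib add_diff_add)
    then show ?thesis by (rule SpI)
  qed
  have Sp_scale_mpoly: "scale_mpoly z h \<in> Sp" if h: "h \<in> Sp" for z h
  proof -
    obtain a where "h - (\<Sum>T\<in>?N. scale_mpoly (a T) (sym_monom n T)) \<in> I" using h by (auto simp: Sp_def)
    from I_scale_mpoly[OF this, of z] have "scale_mpoly z h - (\<Sum>T\<in>?N. scale_mpoly (z * a T) (sym_monom n T)) \<in> I"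
      by (simp add: right_diff_distrib sum_distrib_left scale_mpoly_scale_mpoly)
    then show ?thesis by (rule SpI)
  qed
  have Sp_sum: "(\<Sum>i\<in>S. h i) \<in> Sp" if "\<And>i. i \<in> S \<Longrightarrow> h i \<in> Sp" for S :: "nat multiset set" and h
    using that by (induction S rule: infinite_finite_induct) (auto intro: Sp_add Sp_I I_zero)
  have Sp_diff: "h - k \<in> Sp" if "h \<in> Sp" "k \<in> Sp" for h k
  proof -
    have "scale_mpoly (- 1) k = - k" by (intro poly_mapping_eqI) (simp add: lookup_scale_mpoly)
    with Sp_add[OF that(1) Sp_scale_mpoly[OF that(2), of "- 1"]] show ?thesis by simp
  qed
  have sym_monom_Sp: "sym_monom n T \<in> Sp" if "T \<in> parts d" for T
    using that
  \<comment> \<open>Reduction stays inside the finite set \<open>parts d\<close>, so the number of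
    smaller types of degree \<open>d\<close> decreases with each replacement.\<close>
  proof (induction "card {U \<in> parts d. type_le c U T \<and> U \<noteq> T}" arbitrary: T rule: less_induct)
    case less
    show ?case
    proof (cases "T \<in> leads c")
      case False
      have "(\<Sum>U\<in>?N. scale_mpoly (if U = T then 1 else (0::'a)) (sym_monom n U)) = (\<Sum>U\<in>{T}. sym_monom n U)"
        using False less.prems finite_parts[of d] by (intro sum.mono_neutral_cong_right) auto
      then have "sym_monom n T - (\<Sum>U\<in>?N. scale_mpoly (if U = T then 1 else (0::'a)) (sym_monom n U)) = 0"
        by (simp only: sum.empty sum.insert) simp
      then have "sym_monom n T - (\<Sum>U\<in>?N. scale_mpoly (if U = T then 1 else (0::'a)) (sym_monom n U)) \<in> I"
        by (simp only: I_zero)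
      then show ?thesis by (rule SpI)
    next
      case True
      with wit less.prems obtain f where f: "f \<in> I" "f \<in> polys n" "homogeneous d f" "type_coeff f T \<noteq> 0"
        "\<And>S. type_coeff f S \<noteq> 0 \<Longrightarrow> type_le c S T" by blast
      have T_in: "T \<in> mtype ` keys f" using f(4) type_coeff_eq_0 by blast
      have other: "scale_mpoly (type_coeff f U) (sym_monom n U) \<in> Sp" if U: "U \<in> mtype ` keys f - {T}" for U
      proof (cases "type_coeff f U = 0")
        case True
        then show ?thesis by (simp add: Sp_I I_zero)
      next
        case False
        have Ud: "U \<in> parts d" using mtype_keys_homogeneous[OF f(3)] U by blast
        have le: "type_le c U T" "U \<noteq> T" using f(5)[OF False] U by auto
        have "{V \<in> parts d. type_le c V U \<and> V \<noteq> U} \<subset> {V \<in> parts d. type_le c V T \<and> V \<noteq> T}"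
          using le Ud by (auto intro: type_le_trans dest: type_le_antisym)
        then have "card {V \<in> parts d. type_le c V U \<and> V \<noteq> U} < card {V \<in> parts d. type_le c V T \<and> V \<noteq> T}"
          using finite_parts[of d] by (intro psubset_card_mono) auto
        from less.hyps[OF this Ud] show ?thesis by (rule Sp_scale_mpoly)
      qed
      \<comment> \<open>The average of the witness is again in \<open>I\<close>. Solving its
        expansion for the leading term expresses \<open>sym_monom n T\<close> modulo
        \<open>I\<close> through smaller types.\<close>
      have "reynolds n f = scale_mpoly (type_coeff f T) (sym_monom n T) + (\<Sum>U\<in>mtype ` keys f - {T}. scale_mpoly (type_coeff f U) (sym_monom n U))"
        unfolding reynolds_expand[OF f(2)] using T_in by (intro sum.remove) auto
      then have "scale_mpoly (type_coeff f T) (sym_monom n T) = reynolds n f - (\<Sum>U\<in>mtype ` keys f - {T}. scale_mpoly (type_coeff f U) (sym_monom n U))"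
        by simp
      also have "\<dots> \<in> Sp" by (intro Sp_diff Sp_sum Sp_I[OF I_reynolds[OF n(1) f(1)]] other)
      finally have "scale_mpoly (inverse (type_coeff f T)) (scale_mpoly (type_coeff f T) (sym_monom n T)) \<in> Sp" by (rule Sp_scale_mpoly)
      then show ?thesis using f(4) by (simp add: scale_mpoly_scale_mpoly)
    qed
  qed
  show "\<exists>a. f - (\<Sum>T\<in>?N. scale_mpoly (a T) (sym_monom n T)) \<in> I" if f: "f \<in> inv_piece n d" for f
  proof -
    have f': "f \<in> polys n" "homogeneous d f" "\<And>\<sigma>. \<sigma> \<in> Sym n \<Longrightarrow> act \<sigma> f - f \<in> I"
      using f by (auto simp: inv_piece_def)
    \<comment> \<open>Averaging the congruences between \<open>act \<sigma> f\<close> and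
      \<open>f\<close> shows that \<open>f\<close> is congruent to the invariant
      \<open>reynolds n f\<close>; dividing by n! uses characteristic 0.\<close>
    have "scale_mpoly (inverse (fact n)) (\<Sum>\<sigma>\<in>Sym n. act \<sigma> f - f) =
        reynolds n f - scale_mpoly (inverse (fact n)) (scale_mpoly (fact n) f)"
      by (simp add: reynolds_def sum_subtractf card_Sym right_diff_distrib single_of_nat[symmetric] del: single_of_nat)
    also have "\<dots> = reynolds n f - f" unfolding scale_mpoly_scale_mpoly by simp
    finally have "reynolds n f - f \<in> I" using f'(3) by (metis (no_types, lifting) I_scale_mpoly I_sum)
    from I_uminus[OF this] have "f - reynolds n f \<in> Sp" by (intro Sp_I) simp
    moreover have "reynolds n f \<in> Sp"
      unfolding reynolds_expand[OF f'(1)]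
      using mtype_keys_homogeneous[OF f'(2)] by (intro Sp_sum Sp_scale_mpoly sym_monom_Sp) auto
    ultimately have "(f - reynolds n f) + reynolds n f \<in> Sp" by (rule Sp_add)
    then show ?thesis by (simp add: Sp_def)
  qed
qed

lemma Hilbert_limit:
  "(\<lambda>n. fps_nth (Hilbert_quot_Sym I n) d) \<longlonglongrightarrow> card (parts d - leads c)"
proof -
  obtain n0 where n0: "\<And>n T. n \<ge> n0 \<Longrightarrow> T \<in> parts d \<inter> leads c \<Longrightarrow>
      \<exists>f\<in>I \<inter> polys n. homogeneous d f \<and> type_coeff f T \<noteq> 0 \<and> (\<forall>S. type_coeff f S \<noteq> 0 \<longrightarrow> type_le c S T)"
    using leads_witnesses[of d c] by blast
  \<comment> \<open>\<open>n0\<close> bounds the variables of the witnesses, 1 is the first index in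
    \<open>Sym_infinity\<close>, and \<open>d\<close> leaves room for types with \<open>d\<close>
    entries.\<close>
  have "fps_nth (Hilbert_quot_Sym I n) d = card (parts d - leads c)" if "n \<ge> max n0 (max 1 d)" for n
    using dim_piece[of n d c] n0[of n] that by (simp add: Hilbert_quot_Sym_def)
  then have "\<forall>\<^sub>F n in sequentially. fps_nth (Hilbert_quot_Sym I n) d = card (parts d - leads c)"
    unfolding eventually_sequentially by blast
  then show ?thesis by (rule tendsto_eventually)
qed

end

theorem theorem1p1:
  fixes I :: "'a::field_char_0 mpoly set"
  assumes "homogeneous_ideal I" and "symmetric_ideal I"
  shows "\<exists>L :: nat fps.
    (\<forall>d. (\<lambda>n. fps_nth (Hilbert_quot_Sym I n) d) \<longlonglongrightarrow> fps_nth L d) \<and>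
    (dagger I \<longrightarrow> rational_fps L)"
proof -
  interpret sym_ideal I
    using assms by (intro sym_ideal.intro KX_ideal_char_0.intro KX_ideal.intro sym_ideal_axioms.intro)
      (simp_all add: homogeneous_ideal_def)
  define L where "L c = Abs_fps (\<lambda>d. card (parts d - leads c))" for c
  have lim: "\<forall>d. (\<lambda>n. fps_nth (Hilbert_quot_Sym I n) d) \<longlonglongrightarrow> fps_nth (L c) d" for c
    using Hilbert_limit by (simp add: L_def)
  show ?thesis
  \<comment> \<open>The case decides the cut-off in \<open>L c\<close>: (dagger) supplies a suitable
    \<open>c\<close>, and without it every \<open>c\<close> gives a limit.\<close>
  proof (cases "dagger I")
    case True
    from dagger_leads[OF assms(1) this] obtain c r C where
      C: "C > 0" "c \<le> C" "replicate_mset r C \<in> leads c" by blast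
    from nonleads_rational[OF C(3,2,1)] have "rational_fps (L c)"
      by (simp add: rational_fps_def fps_rat_def L_def)
    with lim show ?thesis by blast
  next
    case False
    with lim show ?thesis by blast
  qed
qed

end
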